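(* Let $s\ge 1$ be an integer. For all integers $\alpha\ge1$ and $j\ge1$, $$\pi_2(c_{\alpha j}^s)\ge 2\alpha+2j-s-2,$$ $$\pi_2(b_{\alpha j}^s)\ge 2\alpha+2j-s-1.$$
   Context: Define the power series $$\Phi_2(q)=\prod_{n\ge1}\frac{1-q^{2n}}{(1-q^n)^2},\quad G_2(q)=q\prod_{n\ge1}\left(\frac{1-q^{2n}}{1-q^n}\right)^{24},\quad G_8=G_8(q)=q\prod_{n\ge1}\frac{(1-q^{8n})^4(1-q^{2n})^2}{(1-q^{4n})^2(1-q^n)^4}.$$ The Atkin operator $U_2$ acts on power series in $q$ by $\left(\sum_{n\ge0}a(n)q^n\right)|U_2=\sum_{n\ge0}a(2n)q^n$. For $s\ge1$ put $$L_1^s=\left(\Phi_2(-q)G_2(-q)^s\right)|U_2,\qquad L_\alpha^s=L_{\alpha-1}^s|U_2\quad(\alpha\ge2).$$ (Here $s$ in $L_\alpha^s$, $b_{\alpha j}^s$, $c_{\alpha j}^s$ is a superscript index, not a power.) The integers $c_{\alpha j}^s$ and $b_{\alpha j}^s$ ($\alpha\ge1$, $j\ge1$) are the coefficients in the expansions $$L_{2\alpha-1}^s=\Phi_2(-q^2)\sum_{j=1}^\infty c_{\alpha j}^s\,G_8^j,\qquad L_{2\alpha}^s=\Phi_2(-q)\sum_{j=1}^\infty b_{\alpha j}^s\,G_8^j,$$ which are uniquely determined because $G_8=q+O(q^2)$ has integer coefficients, $\Phi_2$ has integer coefficients and constant term $1$, and $L_\alpha^s$ has integer coefficients and zero constant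 term for $s\ge1$. $\pi_2$ denotes the $2$-adic valuation on integers, with $\pi_2(0)=\infty$. *)

theory Defs
  imports
    "HOL-Computational_Algebra.Formal_Power_Series"
    "HOL-Analysis.Infinite_Products"
    "HOL-Library.Extended_Real"
begin

unbundle no vec_syntax
unbundle fps_syntax

text \<open>Everything lives in the ring of integer power series; infinite products and sums are taken
  in its usual (coefficientwise) topology. The library's \<^const>\<open>inverse\<close> on power series needs
  an inverse on the coefficients, so over the integers we use its one-sided inverse for constant
  term 1.\<close>

definition recip :: "int fps \<Rightarrow> int fps" where
  "recip f = fps_right_inverse f 1"

definition Phi2 :: "int fps" where
  "Phi2 = prodinf (\<lambda>k. let n = Suc k in
     (1 - fps_X ^ (2 * n)) * recip ((1 - fps_X ^ n) ^ 2))"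

definition G2 :: "int fps" where
  "G2 = fps_X * prodinf (\<lambda>k. let n = Suc k in
     ((1 - fps_X ^ (2 * n)) * recip (1 - fps_X ^ n)) ^ 24)"

definition G8 :: "int fps" where
  "G8 = fps_X * prodinf (\<lambda>k. let n = Suc k in
     (1 - fps_X ^ (8 * n)) ^ 4 * (1 - fps_X ^ (2 * n)) ^ 2
       * recip ((1 - fps_X ^ (4 * n)) ^ 2 * (1 - fps_X ^ n) ^ 4))"

definition U2 :: "int fps \<Rightarrow> int fps" where
  "U2 f = Abs_fps (\<lambda>n. f $ (2 * n))"

text \<open>Only \<^term>\<open>L s \<alpha>\<close> with \<open>\<alpha> \<ge> 1\<close> is meaningful; the value at 0 is a dummy.\<close>

fun L :: "nat \<Rightarrow> nat \<Rightarrow> int fps" where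
  "L s 0 = 0"
| "L s (Suc 0) = U2 ((Phi2 oo - fps_X) * (G2 oo - fps_X) ^ s)"
| "L s (Suc (Suc \<alpha>)) = U2 (L s (Suc \<alpha>))"

text \<open>The expansion of \<open>F\<close> as \<open>P\<close> times a series in \<open>G8, G8\<^sup>2, \<dots>\<close>. The index 0 does not occur
  in it; the first conjunct only fixes the unused value. Unique existence is shown below.\<close>

definition G8_expansion :: "int fps \<Rightarrow> int fps \<Rightarrow> (nat \<Rightarrow> int) \<Rightarrow> bool" where
  "G8_expansion F P a \<longleftrightarrow>
     a 0 = 0 \<and> F = P * (\<Sum>j. fps_const (a (Suc j)) * G8 ^ Suc j)"

definition c_coeff :: "nat \<Rightarrow> nat \<Rightarrow> nat \<Rightarrow> int" where
  "c_coeff s \<alpha> = (THE a. G8_expansion (L s (2 * \<alpha> - 1)) (Phi2 oo - (fps_X ^ 2)) a)"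

definition b_coeff :: "nat \<Rightarrow> nat \<Rightarrow> nat \<Rightarrow> int" where
  "b_coeff s \<alpha> = (THE a. G8_expansion (L s (2 * \<alpha>)) (Phi2 oo - fps_X) a)"

definition pi2 :: "int \<Rightarrow> ereal" where
  "pi2 n = (if n = 0 then \<infinity> else ereal (real (multiplicity 2 n)))"


subsection \<open>Well-definedness\<close>

lemma recip_mult: "f $ 0 = 1 \<Longrightarrow> f * recip f = 1"
  unfolding recip_def by (rule fps_right_inverse) simp

lemma recip_nth_0 [simp]: "recip f $ 0 = 1"
  by (simp add: recip_def)

text \<open>\<open>f\<close> is \<open>1 + O(q\<^sup>n)\<close>\<close>

definition one_upto :: "nat \<Rightarrow> int fps \<Rightarrow> bool" where
  "one_upto n f \<longleftrightarrow> (\<forall>m<n. f $ m = 1 $ m)"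

lemma one_upto_mult_nth:
  assumes "one_upto n g" "m < n"
  shows "(f * g) $ m = f $ m"
proof -
  have "(f * g) $ m = (\<Sum>i=0..m. f $ i * (1 :: int fps) $ (m - i))"
    unfolding fps_mult_nth using assms by (intro sum.cong) (auto simp: one_upto_def)
  also have "\<dots> = (f * 1) $ m" by (simp only: fps_mult_nth)
  finally show ?thesis by simp
qed

lemma one_upto_mult: "one_upto n f \<Longrightarrow> one_upto n g \<Longrightarrow> one_upto n (f * g)"
  using one_upto_mult_nth unfolding one_upto_def by metis

lemma one_upto_power: "one_upto n f \<Longrightarrow> one_upto n (f ^ k)"
  proof (induction k)
  case (Suc k)
  then show ?case unfolding power_Suc by (intro one_upto_mult)
qed (simp add: one_upto_def)

lemma one_upto_X: "n \<le> k \<Longrightarrow> one_upto n (1 - fps_X ^ k)"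
  by (auto simp: one_upto_def fps_X_power_nth)

lemma one_upto_recip: "one_upto n f \<Longrightarrow> one_upto n (recip f)"
proof (cases "n = 0")
  case False
  assume f: "one_upto n f"
  then have "f * recip f = 1" using False by (intro recip_mult) (auto simp: one_upto_def)
  then show ?thesis
    using one_upto_mult_nth[OF f, of _ "recip f"] by (auto simp: one_upto_def mult.commute)
qed (auto simp: one_upto_def)

lemmas one_upto_intros = one_upto_mult one_upto_power one_upto_recip one_upto_X

lemma prod_one_upto_nth:
  assumes "\<And>k. one_upto (Suc k) (F k)" "m \<le> N"
  shows "(\<Prod>k\<le>N. F k) $ m = (\<Prod>k\<le>m. F k) $ m"
  using assms(2)
proof (induction N rule: dec_induct)
  case (step N)
  then show ?case
    using one_upto_mult_nth[OF assms(1)[of "Suc N"], of m "\<Prod>k\<le>N. F k"] by simp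
qed simp

lemma prodinf_one_upto:
  assumes F: "\<And>k. one_upto (Suc k) (F k)"
  shows "F has_prod prodinf F" and "prodinf F $ m = (\<Prod>k\<le>m. F k) $ m"
    and "prodinf F $ 0 = 1"
proof -
  define p where "p = Abs_fps (\<lambda>m. (\<Prod>k\<le>m. F k) $ m)"
  have "(\<lambda>N. \<Prod>k\<le>N. F k) \<longlonglongrightarrow> p"
  proof (unfold tendsto_fps_iff, intro allI)
    fix m
    have "(\<Prod>k\<le>N. F k) $ m = p $ m" if "m \<le> N" for N
      using prod_one_upto_nth[OF F that] by (simp only: p_def fps_nth_Abs_fps)
    then show "eventually (\<lambda>N. (\<Prod>k\<le>N. F k) $ m = p $ m) sequentially"
      unfolding eventually_at_top_linorder by blast
  qed
  moreover have p0: "p $ 0 = 1"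
    using F[of 0] by (simp add: p_def one_upto_def)
  ultimately have hp: "F has_prod p"
    unfolding has_prod_def raw_has_prod_def by (auto simp: fps_eq_iff)
  then have "p = prodinf F"
    by (rule has_prod_unique)
  then show "F has_prod prodinf F" "prodinf F $ m = (\<Prod>k\<le>m. F k) $ m" "prodinf F $ 0 = 1"
    using hp p0 unfolding p_def by (metis fps_nth_Abs_fps)+
qed

lemma Phi2_has_prod:
  "(\<lambda>k. (1 - fps_X ^ (2 * Suc k)) * recip ((1 - fps_X ^ Suc k) ^ 2)) has_prod Phi2"
  and Phi2_nth_0: "Phi2 $ 0 = 1"
  unfolding Phi2_def Let_def
  by (intro prodinf_one_upto one_upto_intros; simp)+

lemma G2_has_prod:
  "\<exists>P. G2 = fps_X * P \<and> P $ 0 = 1 \<and>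
     (\<lambda>k. ((1 - fps_X ^ (2 * Suc k)) * recip (1 - fps_X ^ Suc k)) ^ 24) has_prod P"
  unfolding G2_def Let_def
  by (rule exI, rule conjI[OF refl], intro conjI prodinf_one_upto one_upto_intros; simp)

lemma G8_has_prod:
  "\<exists>P. G8 = fps_X * P \<and> P $ 0 = 1 \<and>
     (\<lambda>k. (1 - fps_X ^ (8 * Suc k)) ^ 4 * (1 - fps_X ^ (2 * Suc k)) ^ 2
       * recip ((1 - fps_X ^ (4 * Suc k)) ^ 2 * (1 - fps_X ^ Suc k) ^ 4)) has_prod P"
  unfolding G8_def Let_def
  by (rule exI, rule conjI[OF refl], intro conjI prodinf_one_upto one_upto_intros; simp)

lemma G2_nth_0: "G2 $ 0 = 0"
proof -
  obtain P where P: "G2 = fps_X * P" using G2_has_prod by blast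
  show ?thesis unfolding P by simp
qed

lemma G8_nth_0: "G8 $ 0 = 0" and G8_nth_1: "G8 $ 1 = 1"
proof -
  obtain P where P: "G8 = fps_X * P" "P $ 0 = 1" using G8_has_prod by blast
  show "G8 $ 0 = 0" "G8 $ 1 = 1" unfolding P(1) using P(2) by simp_all
qed

lemma L_nth_0:
  assumes "s \<ge> 1"
  shows "L s \<alpha> $ 0 = 0"
proof -
  have "((G2 oo - fps_X) ^ s) $ 0 = 0"
    using assms by (simp add: fps_power_zeroth G2_nth_0)
  then have "U2 ((Phi2 oo - fps_X) * (G2 oo - fps_X) ^ s) $ 0 = 0"
    by (simp add: U2_def fps_mult_nth_0 del: fps_power_zeroth)
  then show ?thesis
    by (induction s \<alpha> rule: L.induct) (simp_all add: U2_def)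
qed

lemma G8_sums:
  assumes "a 0 = 0"
  shows "(\<lambda>j. fps_const (a (Suc j)) * G8 ^ Suc j) sums (Abs_fps a oo G8)"
proof -
  have "(\<Sum>j<N. fps_const (a (Suc j)) * G8 ^ Suc j) $ n = (Abs_fps a oo G8) $ n" if "n \<le> N" for n N
  proof -
    have "(\<Sum>j<N. fps_const (a (Suc j)) * G8 ^ Suc j) $ n = (\<Sum>j<N. a (Suc j) * (G8 ^ Suc j) $ n)"
      by (simp only: fps_sum_nth fps_mult_left_const_nth)
    also have "\<dots> = (\<Sum>i\<le>N. a i * (G8 ^ i) $ n)"
      by (simp only: sum.atMost_shift assms)
    also have "\<dots> = (\<Sum>i=0..n. a i * (G8 ^ i) $ n)"
      using that G8_nth_0 by (intro sum.mono_neutral_right) (auto simp: startsby_zero_power_prefix)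
    finally show ?thesis by (simp add: fps_compose_nth)
  qed
  then show ?thesis
    unfolding sums_def tendsto_fps_iff by (auto simp: eventually_at_top_linorder)
qed

lemma G8_expansion_iff:
  assumes "P $ 0 = 1"
  shows "G8_expansion F P a \<longleftrightarrow> a 0 = 0 \<and> Abs_fps a oo G8 = F * recip P"
proof -
  have P: "P * recip P = 1" by (rule recip_mult[OF assms])
  have "F = P * H \<longleftrightarrow> H = F * recip P" for H
  proof
    assume "F = P * H"
    then have "F * recip P = H * (P * recip P)" by (simp only: ac_simps)
    then show "H = F * recip P" unfolding P by simp
  next
    assume "H = F * recip P"
    then have "P * H = F * (P * recip P)" by (simp only: ac_simps)
    then show "F = P * H" unfolding P by simp
  qed
  moreover have "(\<Sum>j. fps_const (a (Suc j)) * G8 ^ Suc j) = Abs_fps a oo G8" if "a 0 = 0"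
    using sums_unique[OF G8_sums[of a, OF that]] by (rule sym)
  ultimately show ?thesis
    unfolding G8_expansion_def by metis
qed

lemma compose_G8_nth:
  "(Abs_fps a oo G8) $ n = a n + (\<Sum>i<n. a i * (G8 ^ i) $ n)"
proof -
  have "(Abs_fps a oo G8) $ n = (\<Sum>i\<in>insert n {..<n}. a i * (G8 ^ i) $ n)"
    unfolding fps_compose_nth by (intro sum.cong) auto
  moreover have "(G8 ^ n) $ n = 1"
    using startsby_zero_power_nth_same[OF G8_nth_0, of n] G8_nth_1 by simp
  ultimately show ?thesis by simp
qed

context
  notes sum.cong [fundef_cong]
begin

fun solve_G8 :: "int fps \<Rightarrow> nat \<Rightarrow> int" where
  "solve_G8 H n = H $ n - (\<Sum>i<n. solve_G8 H i * (G8 ^ i) $ n)"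

end

declare solve_G8.simps [simp del]

lemma G8_expansion_ex1:
  assumes "F $ 0 = 0" "P $ 0 = 1"
  shows "\<exists>!a. G8_expansion F P a"
proof (rule ex1I)
  let ?a = "solve_G8 (F * recip P)"
  have 0: "?a 0 = 0" using assms by (subst solve_G8.simps) simp
  have "(Abs_fps ?a oo G8) $ n = (F * recip P) $ n" for n
    unfolding compose_G8_nth by (subst solve_G8.simps) simp
  then show "G8_expansion F P ?a"
    unfolding G8_expansion_iff[OF assms(2)] using 0 by (auto simp: fps_eq_iff)
  fix a assume "G8_expansion F P a"
  then have a: "Abs_fps a oo G8 = F * recip P"
    unfolding G8_expansion_iff[OF assms(2)] by simp
  have "a n = ?a n" for n
  proof (induction n rule: less_induct)
    case (less n)
    then show ?case
      using compose_G8_nth[of a n] unfolding a by (subst solve_G8.simps) simp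
  qed
  then show "a = ?a" by auto
qed

theorem c_coeff_expansion:
  assumes "s \<ge> 1"
  shows "L s (2 * \<alpha> - 1) =
    (Phi2 oo - (fps_X ^ 2)) * (\<Sum>j. fps_const (c_coeff s \<alpha> (Suc j)) * G8 ^ Suc j)"
proof -
  have "\<exists>!a. G8_expansion (L s (2 * \<alpha> - 1)) (Phi2 oo - (fps_X ^ 2)) a"
    using L_nth_0[OF assms] by (intro G8_expansion_ex1) (auto simp: Phi2_nth_0)
  then show ?thesis
    using theI'[of "G8_expansion (L s (2 * \<alpha> - 1)) (Phi2 oo - (fps_X ^ 2))"]
    unfolding c_coeff_def[symmetric] by (simp add: G8_expansion_def)
qed

theorem b_coeff_expansion:
  assumes "s \<ge> 1"
  shows "L s (2 * \<alpha>) =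
    (Phi2 oo - fps_X) * (\<Sum>j. fps_const (b_coeff s \<alpha> (Suc j)) * G8 ^ Suc j)"
proof -
  have "\<exists>!a. G8_expansion (L s (2 * \<alpha>)) (Phi2 oo - fps_X) a"
    using L_nth_0[OF assms] by (intro G8_expansion_ex1) (auto simp: Phi2_nth_0)
  then show ?thesis
    using theI'[of "G8_expansion (L s (2 * \<alpha>)) (Phi2 oo - fps_X)"]
    unfolding b_coeff_def[symmetric] by (simp add: G8_expansion_def)
qed

end

theory Submission
  imports Defs "HOL-Computational_Algebra.Polynomial_FPS"
begin

text \<open>Let \<open>\<phi>(q) = \<Sum>q\<^bsup>n\<^sup>2\<^esup>\<close> over all integers \<open>n\<close>, and \<open>Y = 4 G8\<close>. By Gauss's product formula
  (\<open>theta_product\<close>), \<open>\<Phi>\<^sub>2(-q) = 1 / \<phi>(q)\<close>, and \<open>G8\<close> and \<open>G2\<close> become rational functions of \<open>\<phi>(q)\<close> and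
  \<open>\<phi>(-q)\<close> (\<open>G8_theta\<close>, \<open>G2_theta\<close>). The classical quadratic relations between theta series then show that
  \<open>Y(q)\<close> and \<open>Y(-q)\<close> are the two roots of
  \<open>y\<^sup>2 = 8K(q\<^sup>2) y + 4K(q\<^sup>2)\<close>, where \<open>K = Y + Y\<^sup>2\<close> (\<open>Y_quadratic\<close>).

  The operator \<open>U2\<close> takes the even part and replaces \<open>q\<^sup>2\<close> by \<open>q\<close>, hence it is linear over series in \<open>q\<^sup>2\<close>.
  So for either root \<open>y\<close> and any series \<open>F\<close>, the series \<open>u\<^sub>j = U2 (F y\<^sup>j)\<close> satisfy
  \<open>u\<^sub>j\<^sub>+\<^sub>2 = 8K u\<^sub>j\<^sub>+\<^sub>1 + 4K u\<^sub>j\<close>. If \<open>u\<^sub>0\<close> and \<open>u\<^sub>1\<close> lie in \<open>C \<int>[Y]\<close> and \<open>2 C Y \<int>[Y]\<close>, it follows that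
  \<open>u\<^sub>j\<close> lies in \<open>2\<^sup>j C Y \<int>[Y]\<close> for \<open>j \<ge> 1\<close> (\<open>U2_power\<close>). The initial values are computed from the theta
  identities, and they have this form for \<open>F = \<Phi>\<^sub>2(-q)\<close> with \<open>C = \<Phi>\<^sub>2(-q\<^sup>2)\<close>, as well as for
  \<open>F = \<Phi>\<^sub>2(-q\<^sup>2)\<close> with \<open>C = \<Phi>\<^sub>2(-q)\<close>. Thus each step from \<open>L s n\<close> to \<open>L s (n + 1)\<close> gains a factor 2.

  The first step is different. There \<open>4 G2(-q)\<close> is \<open>Y(-q)\<close> times an integral polynomial in \<open>Y(-q)\<close>
  (\<open>G2_negX\<close>), so replacing \<open>G2(-q)\<^sup>s\<close> by such a polynomial costs \<open>4\<^sup>s\<close>, but the result is a multiple of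
  \<open>Y(-q)\<^sup>s\<close>, and \<open>U2\<close> gives back \<open>2\<^sup>s\<close>. Altogether \<open>2\<^sup>s L s n\<close> lies in \<open>2\<^sup>n\<^sup>-\<^sup>1 C Y \<int>[Y]\<close>
  (\<open>L_int_polys\<close>). Comparison of coefficients, with \<open>Y\<^sup>j = 2\<^sup>2\<^sup>j G8\<^sup>j\<close>, yields both bounds.\<close>

section \<open>Substituting -q and powers of q\<close>

abbreviation negX :: "int fps \<Rightarrow> int fps" where
  "negX f \<equiv> f oo - fps_X"

abbreviation powX :: "nat \<Rightarrow> int fps \<Rightarrow> int fps" where
  "powX j f \<equiv> f oo fps_X ^ j"

lemma compose_ring_simps:
  fixes c :: "int fps"
  assumes "c $ 0 = 0"
  shows "(f * g) oo c = (f oo c) * (g oo c)" "(f + g) oo c = (f oo c) + (g oo c)"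
    "(f - g) oo c = (f oo c) - (g oo c)" "(f ^ n) oo c = (f oo c) ^ n" "(- f) oo c = - (f oo c)"
  using fps_compose_power[OF assms, of f n] fps_compose_mult_distrib[OF assms]
  by (simp_all add: fps_compose_add_distrib fps_compose_sub_distrib fps_compose_uminus)

lemma negX_simps [simp]:
  "negX (f * g) = negX f * negX g" "negX (f + g) = negX f + negX g"
  "negX (f - g) = negX f - negX g" "negX (f ^ n) = negX f ^ n" "negX (- f) = - negX f"
  by (rule compose_ring_simps; simp)+

lemma powX_simps:
  assumes "j > 0"
  shows "powX j (f * g) = powX j f * powX j g" "powX j (f + g) = powX j f + powX j g"
    "powX j (f - g) = powX j f - powX j g" "powX j (f ^ n) = powX j f ^ n"
    "powX j (- f) = - powX j f"
  by (rule compose_ring_simps; use assms in simp)+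

lemma negX_nth: "negX f $ n = (-1) ^ n * f $ n"
  by (simp add: fps_compose_uminus')

lemma powX_nth:
  assumes "j > 0"
  shows "powX j f $ n = (if j dvd n then f $ (n div j) else 0)"
proof -
  have "powX j f $ n = (\<Sum>i = 0..n. if i * j = n then f $ i else 0)"
    by (auto simp: fps_compose_nth fps_X_power_nth power_mult [symmetric] mult.commute intro!: sum.cong)
  also have "\<dots> = (\<Sum>i = 0..n. if j dvd n \<and> i = n div j then f $ i else 0)"
    using assms by (intro sum.cong) auto
  also have "\<dots> = (if j dvd n then f $ (n div j) else 0)"
    by (auto simp: sum.delta)
  finally show ?thesis .
qed

lemma negX_negX [simp]: "negX (negX f) = f"
  by (simp add: fps_eq_iff negX_nth power_mult_distrib [symmetric] mult.assoc [symmetric])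

lemma negX_powX: "even j \<Longrightarrow> j > 0 \<Longrightarrow> negX (powX j f) = powX j f"
  by (auto simp: fps_eq_iff negX_nth powX_nth)

lemma powX_powX: "i > 0 \<Longrightarrow> j > 0 \<Longrightarrow> powX i (powX j f) = powX (i * j) f"
  by (auto simp: fps_eq_iff powX_nth div_mult2_eq dvd_div_iff_mult mult.commute dvd_mult_left
           dest: dvd_mult_right)

lemma powX_inj: "j > 0 \<Longrightarrow> powX j f = powX j g \<Longrightarrow> f = g"
  unfolding fps_eq_iff powX_nth by (metis dvd_triv_left nonzero_mult_div_cancel_left less_irrefl)

section \<open>Infinite products of integer power series\<close>

lemma one_upto_nth_0: "one_upto (Suc k) f \<Longrightarrow> f $ 0 = 1"
  by (simp add: one_upto_def)

lemma one_upto_mono: "one_upto n f \<Longrightarrow> m \<le> n \<Longrightarrow> one_upto m f"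
  by (auto simp: one_upto_def)

lemma prodinf_nth_le:
  assumes "\<And>k. one_upto (Suc k) (F k)" "m \<le> N"
  shows "prodinf F $ m = (\<Prod>k\<le>N. F k) $ m"
  using prodinf_one_upto(2)[OF assms(1)] prod_one_upto_nth[OF assms] by simp

lemma fps_mult_nth_cong:
  fixes f g f' g' :: "'a :: comm_ring_1 fps"
  assumes "\<And>m. m \<le> n \<Longrightarrow> f $ m = f' $ m" "\<And>m. m \<le> n \<Longrightarrow> g $ m = g' $ m"
  shows "(f * g) $ n = (f' * g') $ n"
  unfolding fps_mult_nth by (intro sum.cong) (use assms in auto)

lemma prodinf_mult_fps:
  assumes F: "\<And>k. one_upto (Suc k) (F k)" and G: "\<And>k. one_upto (Suc k) (G k)"
  shows "prodinf (\<lambda>k. F k * G k) = prodinf F * prodinf G"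
proof (rule fps_ext)
  fix n
  have "(prodinf F * prodinf G) $ n = ((\<Prod>k\<le>n. F k) * (\<Prod>k\<le>n. G k)) $ n"
    by (intro fps_mult_nth_cong prodinf_nth_le F G)
  also have "\<dots> = prodinf (\<lambda>k. F k * G k) $ n"
    by (subst prodinf_nth_le[of _ n n]) (auto intro: one_upto_mult F G simp: prod.distrib)
  finally show "prodinf (\<lambda>k. F k * G k) $ n = (prodinf F * prodinf G) $ n" ..
qed

lemma prodinf_power_fps:
  assumes F: "\<And>k. one_upto (Suc k) (F k)"
  shows "prodinf (\<lambda>k. F k ^ n) = prodinf F ^ n"
proof (induction n)
  case (Suc n)
  then show ?case
    by (simp add: prodinf_mult_fps[OF F one_upto_power[OF F]])
next
  case 0
  have "prodinf (\<lambda>_. 1 :: int fps) $ m = 1 $ m" for m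
    by (subst prodinf_nth_le[of _ m m]) (auto simp: one_upto_def)
  then show ?case by (simp add: fps_eq_iff)
qed

lemma one_upto_compose:
  assumes "one_upto n f" "c $ 0 = 0"
  shows "one_upto n (f oo c)"
proof -
  have "(f oo c) $ m = 1 $ m" if "m < n" for m
  proof -
    have "(f oo c) $ m = (1 oo c) $ m"
      unfolding fps_compose_nth using assms(1) that
      by (intro sum.cong) (auto simp: one_upto_def)
    then show ?thesis by simp
  qed
  then show ?thesis by (simp add: one_upto_def)
qed

lemma prodinf_compose_fps:
  assumes F: "\<And>k. one_upto (Suc k) (F k)" and c: "c $ 0 = 0"
  shows "prodinf F oo c = prodinf (\<lambda>k. F k oo c)"
proof (rule fps_ext)
  fix n
  have "(prodinf F oo c) $ n = ((\<Prod>k\<le>n. F k) oo c) $ n"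
    unfolding fps_compose_nth
    by (intro sum.cong refl arg_cong2[of _ _ _ _ times] prodinf_nth_le F) auto
  also have "(\<Prod>k\<le>n. F k) oo c = (\<Prod>k\<le>n. F k oo c)"
    by (rule fps_compose_prod_distrib[OF c])
  also have "\<dots> $ n = prodinf (\<lambda>k. F k oo c) $ n"
    by (rule prodinf_nth_le[symmetric]) (auto intro: one_upto_compose F c)
  finally show "(prodinf F oo c) $ n = prodinf (\<lambda>k. F k oo c) $ n" .
qed

text \<open>Separating the factors of even and odd index is legitimate because factor \<open>k\<close> is
  \<open>1 + O(q\<^sup>k\<^sup>+\<^sup>1)\<close>: each coefficient depends on finitely many factors.\<close>

lemma prodinf_pair_fps:
  assumes F: "\<And>k. one_upto (Suc k) (F k)"
  shows "prodinf F = prodinf (\<lambda>k. F (2 * k)) * prodinf (\<lambda>k. F (2 * k + 1))"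
proof -
  have E: "one_upto (Suc k) (F (2 * k))" "one_upto (Suc k) (F (2 * k + 1))" for k
    by (rule one_upto_mono[OF F]; simp)+
  have split: "(\<Prod>k\<le>2 * n + 1. F k) = (\<Prod>k\<le>n. F (2 * k) * F (2 * k + 1))" for n
    by (induction n) (simp_all add: mult.assoc)
  have "prodinf F $ n = prodinf (\<lambda>k. F (2 * k) * F (2 * k + 1)) $ n" for n
    using prodinf_nth_le[OF F, of n "2 * n + 1"]
      prodinf_nth_le[of "\<lambda>k. F (2 * k) * F (2 * k + 1)" n n, OF one_upto_mult[OF E]]
    unfolding split by simp
  then have "prodinf F = prodinf (\<lambda>k. F (2 * k) * F (2 * k + 1))"
    by (simp add: fps_eq_iff)
  then show ?thesis
    unfolding prodinf_mult_fps[OF E] .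
qed

section \<open>Eta quotients\<close>

text \<open>All products in question are quotients of the series \<open>E(q\<^sup>j)\<close>, where \<open>E(q)\<close> is Euler's product
  \<open>\<Prod>(1 - q\<^sup>k)\<close>.\<close>

definition euler :: "nat \<Rightarrow> int fps" where
  "euler j = prodinf (\<lambda>k. 1 - fps_X ^ (j * Suc k))"

lemma one_upto_euler: "j > 0 \<Longrightarrow> one_upto (Suc k) (1 - fps_X ^ (j * Suc k))"
  by (rule one_upto_X) (cases j; simp)

lemma euler_nth_0: "j > 0 \<Longrightarrow> euler j $ 0 = 1"
  unfolding euler_def by (rule prodinf_one_upto(3)) (rule one_upto_euler)

lemma euler_nonzero: "j > 0 \<Longrightarrow> euler j \<noteq> 0"
  using euler_nth_0 by (metis fps_zero_nth zero_neq_one)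

lemma powX_euler: "i > 0 \<Longrightarrow> j > 0 \<Longrightarrow> powX i (euler j) = euler (i * j)"
  unfolding euler_def
  by (subst prodinf_compose_fps)
     (auto intro: one_upto_euler simp: powX_simps power_mult [symmetric] mult.assoc [symmetric]
           simp del: mult_Suc_right)

lemma euler_power: "j > 0 \<Longrightarrow> prodinf (\<lambda>k. (1 - fps_X ^ (j * Suc k)) ^ n) = euler j ^ n"
  unfolding euler_def by (rule prodinf_power_fps) (rule one_upto_euler)

lemma prodinf_recip_cancel:
  assumes F: "\<And>k. one_upto (Suc k) (F k)" and G: "\<And>k. one_upto (Suc k) (G k)"
  shows "prodinf (\<lambda>k. F k * recip (G k)) * prodinf G = prodinf F"
proof -
  have "F k * recip (G k) * G k = F k" for k
    using recip_mult[OF one_upto_nth_0[OF G[of k]]] by (simp add: ac_simps)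
  then show ?thesis
    unfolding prodinf_mult_fps[OF one_upto_mult[OF F one_upto_recip[OF G]] G, symmetric] by (simp only:)
qed

lemma Phi2_eta: "Phi2 * euler 1 ^ 2 = euler 2"
proof -
  let ?A = "\<lambda>k. 1 - fps_X ^ (2 * Suc k) :: int fps" and ?B = "\<lambda>k. (1 - fps_X ^ (1 * Suc k)) ^ 2"
  have "prodinf (\<lambda>k. ?A k * recip (?B k)) * prodinf ?B = prodinf ?A"
    by (rule prodinf_recip_cancel; intro one_upto_power one_upto_euler; simp)
  moreover have "prodinf ?B = euler 1 ^ 2"
    by (simp only: euler_power)
  ultimately show ?thesis
    unfolding Phi2_def Let_def euler_def[of 2] by simp
qed

lemma G2_eta: "G2 * euler 1 ^ 24 = fps_X * euler 2 ^ 24"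
proof -
  let ?A = "\<lambda>k. 1 - fps_X ^ (2 * Suc k) :: int fps" and ?B = "\<lambda>k. 1 - fps_X ^ (1 * Suc k)"
  have "prodinf (\<lambda>k. (?A k * recip (?B k)) ^ 24) = prodinf (\<lambda>k. ?A k * recip (?B k)) ^ 24"
    by (rule prodinf_power_fps) (intro one_upto_mult one_upto_recip one_upto_euler; simp)
  moreover have "prodinf (\<lambda>k. ?A k * recip (?B k)) * prodinf ?B = prodinf ?A"
    by (rule prodinf_recip_cancel; intro one_upto_euler; simp)
  ultimately have "prodinf (\<lambda>k. (?A k * recip (?B k)) ^ 24) * prodinf ?B ^ 24 = prodinf ?A ^ 24"
    by (simp only: power_mult_distrib [symmetric])
  then show ?thesis
    unfolding G2_def Let_def euler_def by (simp add: mult.assoc)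
qed

lemma G8_eta: "G8 * (euler 4 ^ 2 * euler 1 ^ 4) = fps_X * (euler 8 ^ 4 * euler 2 ^ 2)"
proof -
  let ?A = "\<lambda>k. (1 - fps_X ^ (8 * Suc k)) ^ 4 * (1 - fps_X ^ (2 * Suc k)) ^ 2"
  let ?B = "\<lambda>k. (1 - fps_X ^ (4 * Suc k)) ^ 2 * (1 - fps_X ^ (1 * Suc k)) ^ 4"
  have "prodinf ?A = euler 8 ^ 4 * euler 2 ^ 2" "prodinf ?B = euler 4 ^ 2 * euler 1 ^ 4"
    by (subst prodinf_mult_fps; (intro one_upto_power one_upto_euler)?; simp only: euler_power; simp)+
  moreover have "prodinf (\<lambda>k. ?A k * recip (?B k)) * prodinf ?B = prodinf ?A"
    by (rule prodinf_recip_cancel) (intro one_upto_mult one_upto_power one_upto_euler; simp)+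
  ultimately show ?thesis
    unfolding G8_def Let_def by (simp add: mult.assoc)
qed

lemma euler_split_odd:
  "euler 1 = prodinf (\<lambda>k. 1 - fps_X ^ (2 * k + 1)) * euler 2"
proof -
  have "euler 1 = prodinf (\<lambda>k. 1 - fps_X ^ (1 * Suc (2 * k))) * prodinf (\<lambda>k. 1 - fps_X ^ (1 * Suc (2 * k + 1)))"
    unfolding euler_def by (rule prodinf_pair_fps) (rule one_upto_euler, simp)
  moreover have "1 * Suc (2 * k) = 2 * k + 1" "1 * Suc (2 * k + 1) = 2 * Suc k" for k
    by simp_all
  ultimately show ?thesis
    unfolding euler_def by (simp only:)
qed

lemma negX_euler_2: "negX (euler 2) = euler 2"
  using negX_powX[of 2 "euler 1"] by (simp add: powX_euler)

text \<open>With \<open>A(q)\<close> the product of the odd-index factors of \<open>E(q)\<close>, one has \<open>E(q) = A(q) E(q\<^sup>2)\<close> and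
  \<open>A(q) A(-q) = A(q\<^sup>2)\<close>, because an odd power of \<open>-q\<close> changes sign and an even one does not.\<close>

lemma negX_euler: "negX (euler 1) * euler 1 * euler 4 = euler 2 ^ 3"
proof -
  define A :: "int fps" where "A = prodinf (\<lambda>k. 1 - fps_X ^ (2 * k + 1))"
  have o: "one_upto (Suc k) (1 - fps_X ^ (2 * k + 1))" for k
    by (rule one_upto_X) simp
  have e1: "euler 1 = A * euler 2"
    unfolding A_def by (rule euler_split_odd)
  have e2: "euler 2 = powX 2 A * euler 4"
    using arg_cong[OF e1, of "powX 2"] by (simp add: powX_euler powX_simps)
  have "negX A * A = powX 2 A"
  proof -
    have "negX (1 - fps_X ^ (2 * k + 1)) * (1 - fps_X ^ (2 * k + 1))
        = powX 2 (1 - fps_X ^ (2 * k + 1))" for k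
    proof -
      have "negX (1 - fps_X ^ (2 * k + 1)) = 1 + fps_X ^ (2 * k + 1)"
        by (simp only: negX_simps) simp
      moreover have "powX 2 (1 - fps_X ^ (2 * k + 1)) = 1 - (fps_X ^ (2 * k + 1)) ^ 2"
        by (subst powX_simps, simp)+ (simp flip: power_mult del: power_Suc add: mult.commute)
      ultimately show ?thesis
        by (simp add: algebra_simps power2_eq_square)
    qed
    moreover have "negX (prodinf (\<lambda>k. 1 - fps_X ^ (2 * k + 1))) =
        prodinf (\<lambda>k. negX (1 - fps_X ^ (2 * k + 1)))"
      "powX 2 (prodinf (\<lambda>k. 1 - fps_X ^ (2 * k + 1))) =
        prodinf (\<lambda>k. powX 2 (1 - fps_X ^ (2 * k + 1)))"
      by (rule prodinf_compose_fps[OF o]; simp)+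
    ultimately show ?thesis
      using prodinf_mult_fps[OF one_upto_compose[OF o, of "- fps_X"] o] unfolding A_def by simp
  qed
  with negX_euler_2 have "negX (euler 1) * euler 1 * euler 4 = powX 2 A * euler 4 * euler 2 ^ 2"
    unfolding e1 by (simp add: power2_eq_square ac_simps)
  also have "\<dots> = euler 2 ^ 3"
    unfolding e2 [symmetric] by (simp add: power2_eq_square power3_eq_cube)
  finally show ?thesis .
qed

section \<open>Gauss's product for the theta series\<close>

text \<open>The theta series \<open>\<phi>(q) = \<Sum>q\<^bsup>n\<^sup>2\<^esup>\<close>, summed over all integers \<open>n\<close>; a positive
  square has two integer roots.\<close>

definition theta :: "int fps" where
  "theta = Abs_fps (\<lambda>n. if n = 0 then 1 else if \<exists>k. n = k ^ 2 then 2 else 0)"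

lemma negX_theta_nth_partial_sum:
  assumes "m \<le> n"
  shows "negX theta $ m = (1 + 2 * (\<Sum>k<n. (- 1) ^ Suc k * fps_X ^ (Suc k ^ 2))) $ m"
proof -
  have eq: "((- 1) ^ Suc k * fps_X ^ (Suc k ^ 2) :: int fps) $ m
      = (if m = Suc k ^ 2 then (- 1) ^ m else 0)" for k
  proof -
    have "(- 1) ^ Suc k * fps_X ^ (Suc k ^ 2) = fps_const ((- 1 :: int) ^ Suc k) * fps_X ^ (Suc k ^ 2)"
      by (simp flip: fps_const_power fps_const_neg)
    then have "((- 1) ^ Suc k * fps_X ^ (Suc k ^ 2) :: int fps) $ m
        = (- 1) ^ Suc k * (if m = Suc k ^ 2 then 1 else 0)"
      by (simp only: fps_mult_left_const_nth fps_X_power_nth)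
    moreover have "(- 1 :: int) ^ Suc k = (- 1) ^ (Suc k ^ 2)"
      by (cases "even k") (auto simp: uminus_power_if)
    ultimately show ?thesis by (auto simp del: power_Suc)
  qed
  have "(2 * f) $ m = 2 * f $ m" for f :: "int fps"
    by (simp add: numeral_fps_const)
  then have R: "(1 + 2 * (\<Sum>k<n. (- 1) ^ Suc k * fps_X ^ (Suc k ^ 2))) $ m
      = (if m = 0 then 1 else 0) + 2 * (\<Sum>k<n. if m = Suc k ^ 2 then (- 1) ^ m else (0 :: int))"
    by (simp only: fps_add_nth fps_sum_nth eq fps_one_nth)
  show ?thesis
  proof (cases "\<exists>k. m = Suc k ^ 2")
    case True
    then obtain k where k: "m = Suc k ^ 2" by blast
    then have "k < n"
      using assms power2_nat_le_imp_le[of "Suc k" m] by simp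
    have "(\<Sum>i<n. if m = Suc i ^ 2 then (- 1) ^ m else (0 :: int)) = (\<Sum>i<n. if i = k then (- 1) ^ m else 0)"
      by (intro sum.cong) (auto simp: k power2_eq_iff_nonneg simp del: of_nat_Suc)
    then show ?thesis
      unfolding R using \<open>k < n\<close> k by (auto simp: negX_nth theta_def)
  next
    case False
    then have "m = 0 \<or> \<not> (\<exists>k. m = k ^ 2)"
      by (metis not0_implies_Suc power_zero_numeral)
    then show ?thesis
      unfolding R using False by (auto simp: negX_nth theta_def)
  qed
qed

text \<open>A finite form of Gauss's identity, in the style of Shanks. With \<open>P\<^sub>n = \<Prod>(1 - q\<^sup>k) / (1 + q\<^sup>k)\<close> over
  \<open>1 \<le> k \<le> n\<close>, the sum on the left is \<open>\<Sum>(-1)\<^sup>s 2 / (1 + q\<^sup>s) P\<^sub>n / P\<^sub>s q\<^bsup>s(n+1)\<^esup>\<close>. Modulo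
  \<open>q\<^bsup>n+1\<^esup>\<close> it reduces to its term \<open>s = 0\<close>, which is \<open>P\<^sub>n\<close>, so letting \<open>n\<close> grow yields the infinite
  product. The induction step holds because the increment of the sum, times \<open>1 + q\<^bsup>n+1\<^esup>\<close>, telescopes
  in \<open>s\<close>. The separate value of \<open>c 0\<close> stands for \<open>2 / (1 + q\<^sup>0) = 1\<close>, as 2 is not invertible over
  the integers.\<close>

lemma gauss_partial_sum:
  fixes n :: nat
  defines "r \<equiv> (\<lambda>k. recip (1 + fps_X ^ k))"
  defines "c \<equiv> (\<lambda>s. if s = 0 then 1 else 2 * r s)"
  defines "F \<equiv> (\<lambda>n s. \<Prod>k\<in>{s..<n}. (1 - fps_X ^ Suc k) * r (Suc k))"
  shows "(\<Sum>s\<le>n. (- 1) ^ s * c s * F n s * fps_X ^ (s * Suc n))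
      = 1 + 2 * (\<Sum>k<n. (- 1) ^ Suc k * fps_X ^ (Suc k ^ 2))"
proof (induction n)
  case 0
  show ?case by (simp add: c_def F_def)
next
  case (Suc n)
  define t where "t n s = (- 1) ^ s * c s * F n s * fps_X ^ (s * Suc n)" for n s
  define N where "N = Suc n"
  have r: "(1 + fps_X ^ Suc k) * r (Suc k) = 1" for k
    unfolding r_def by (rule recip_mult) simp
  have c: "c s * (1 + fps_X ^ s) = 2" for s
    using r[of "s - 1"] by (cases s) (simp_all add: c_def ac_simps)
  define d where "d s = (if s = 0 then 0 else (1 - fps_X ^ s) * r s)" for s
  have d: "c s * (1 - fps_X ^ s) = 2 * d s" for s
    by (simp add: c_def d_def mult.assoc mult.left_commute)
  define A where "A s = F n s * fps_X ^ (Suc s * N)" for s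
  define B where "B s = F n s * fps_X ^ (s * N) * d s" for s
  \<comment> \<open>Consecutive terms of the alternating sum over \<open>s\<close> cancel, as \<open>P\<^sub>s\<^sub>+\<^sub>1 = P\<^sub>s d\<^sub>s\<^sub>+\<^sub>1\<close>.\<close>
  have BA: "B (Suc s) = A s" if "s < n" for s
    using that unfolding A_def B_def F_def
    by (simp add: prod.atLeast_Suc_lessThan d_def mult_ac)
  have tele: "(\<Sum>s\<le>m. (- 1) ^ s * (B s + A s)) = (- 1) ^ m * A m" if "m \<le> n" for m
    using that
  proof (induction m)
    case (Suc m)
    then show ?case using BA[of m] by (simp add: algebra_simps)
  qed (simp add: B_def d_def)
  have FN: "(1 + fps_X ^ N) * F N s = F n s * (1 - fps_X ^ N)" if "s \<le> n" for s
    using that r[of n] by (simp add: F_def N_def ac_simps)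
  have diff: "(1 + fps_X ^ N) * (t N s - t n s) = - 2 * ((- 1) ^ s * (B s + A s))" if "s \<le> n" for s
  proof -
    have pw: "(fps_X :: int fps) ^ (s * Suc N) = fps_X ^ (s * N) * fps_X ^ s"
      "(fps_X :: int fps) ^ (s * Suc n) = fps_X ^ (s * N)"
      "(fps_X :: int fps) ^ (Suc s * N) = fps_X ^ (s * N) * fps_X ^ N"
      for s by (simp_all add: N_def power_add mult_ac)
    have "(1 + fps_X ^ N) * (t N s - t n s) = (- 1) ^ s * fps_X ^ (s * N) * c s *
        ((1 + fps_X ^ N) * F N s * fps_X ^ s - (1 + fps_X ^ N) * F n s)"
      unfolding t_def pw by (simp add: algebra_simps)
    also have "\<dots> = - ((- 1) ^ s * fps_X ^ (s * N) * F n s *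
        (c s * (1 - fps_X ^ s) + fps_X ^ N * (c s * (1 + fps_X ^ s))))"
      unfolding FN[OF that] by (simp add: algebra_simps)
    also have "\<dots> = - 2 * ((- 1) ^ s * (B s + A s))"
      unfolding c d A_def B_def pw by (simp add: algebra_simps)
    finally show ?thesis .
  qed
  have "(1 + fps_X ^ N) * ((\<Sum>s\<le>N. t N s) - (\<Sum>s\<le>n. t n s))
      = (\<Sum>s\<le>n. (1 + fps_X ^ N) * (t N s - t n s)) + (1 + fps_X ^ N) * t N N"
    unfolding sum_distrib_left [symmetric] sum_subtractf
    by (simp add: N_def algebra_simps del: power_Suc)
  also have "(\<Sum>s\<le>n. (1 + fps_X ^ N) * (t N s - t n s)) = - 2 * ((- 1) ^ n * A n)"
    unfolding tele[OF order.refl, symmetric] sum_distrib_left by (intro sum.cong) (auto simp: diff)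
  also have "A n = fps_X ^ (N ^ 2)"
    by (simp add: A_def F_def N_def power2_eq_square)
  also have "(1 + fps_X ^ N) * t N N = (- 1) ^ N * (c N * (1 + fps_X ^ N)) * fps_X ^ (N ^ 2) * fps_X ^ N"
    unfolding t_def by (simp add: F_def power2_eq_square power_add mult_ac)
  also have "- 2 * ((- 1) ^ n * fps_X ^ (N ^ 2)) + (- 1) ^ N * (c N * (1 + fps_X ^ N)) * fps_X ^ (N ^ 2) * fps_X ^ N
      = (1 + fps_X ^ N) * (2 * ((- 1) ^ N * fps_X ^ (N ^ 2)))"
    unfolding c by (simp add: N_def algebra_simps)
  finally have "(\<Sum>s\<le>N. t N s) - (\<Sum>s\<le>n. t n s) = 2 * ((- 1) ^ N * fps_X ^ (N ^ 2))"
    using r[of n] unfolding N_def by (metis mult_cancel_left mult_zero_left zero_neq_one)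
  then show ?case
    using Suc unfolding t_def N_def by (simp add: algebra_simps)
qed

text \<open>The product formula \<open>\<phi>(-q) = \<Prod>(1 - q\<^sup>k) / (1 + q\<^sup>k)\<close>, with denominators cleared.\<close>

lemma theta_product: "negX theta * euler 2 = euler 1 ^ 2"
proof -
  define Q where "Q = (\<lambda>k. (1 - fps_X ^ Suc k) * recip (1 + fps_X ^ Suc k))"
  define c where "c = (\<lambda>s. if s = 0 then 1 else 2 * recip (1 + fps_X ^ s))"
  define F where "F n s = (\<Prod>k\<in>{s..<n}. Q k)" for n s
  have plus: "one_upto (Suc k) (1 + fps_X ^ Suc k)" and minus: "one_upto (Suc k) (1 - fps_X ^ Suc k)" for k
    by (auto simp: one_upto_def fps_X_power_nth simp del: power_Suc)
  have Q: "one_upto (Suc k) (Q k)" for k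
    unfolding Q_def by (intro one_upto_mult one_upto_recip plus minus)
  have "negX theta = prodinf Q"
  proof (rule fps_ext)
    fix n
    \<comment> \<open>The terms with \<open>s > 0\<close> start beyond degree \<open>n\<close>.\<close>
    have lt: "n < s * Suc (Suc n)" if "s > 0" for s
      using that by (cases s) auto
    have "negX theta $ n = (\<Sum>s\<le>Suc n. (- 1) ^ s * c s * F (Suc n) s * fps_X ^ (s * Suc (Suc n))) $ n"
      using negX_theta_nth_partial_sum[of n "Suc n"] gauss_partial_sum[of "Suc n"]
      unfolding c_def F_def Q_def by simp
    also have "(\<Sum>s\<le>Suc n. (- 1) ^ s * c s * F (Suc n) s * fps_X ^ (s * Suc (Suc n))) $ n
        = (\<Sum>s\<le>Suc n. if s = 0 then F (Suc n) 0 $ n else 0)"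
      unfolding fps_sum_nth by (intro sum.cong) (auto simp: c_def fps_X_power_mult_right_nth dest: lt simp del: power_Suc mult_Suc_right)
    also have "\<dots> = (\<Prod>k\<le>n. Q k) $ n"
      by (simp add: F_def atLeast0LessThan lessThan_Suc_atMost)
    also have "\<dots> = prodinf Q $ n"
      by (rule prodinf_nth_le[symmetric, OF Q order.refl])
    finally show "negX theta $ n = prodinf Q $ n" .
  qed
  moreover have "prodinf Q * prodinf (\<lambda>k. 1 + fps_X ^ Suc k) = euler 1"
    unfolding Q_def euler_def by (subst prodinf_recip_cancel[OF minus plus]) (simp del: power_Suc)
  moreover have "prodinf (\<lambda>k. 1 + fps_X ^ Suc k) * euler 1 = euler 2"
  proof -
    have "(1 + fps_X ^ Suc k) * (1 - fps_X ^ Suc k) = (1 - fps_X ^ (2 * Suc k) :: int fps)" for k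
      unfolding mult_2 power_add by (simp add: algebra_simps del: power_Suc)
    then show ?thesis
      using prodinf_mult_fps[OF plus minus] unfolding euler_def by (simp only: mult_1)
  qed
  ultimately show ?thesis
    by (metis mult.assoc power2_eq_square)
qed

section \<open>Theta identities\<close>

lemma theta_nth_0 [simp]: "theta $ 0 = 1"
  by (simp add: theta_def)

lemma theta_nonzero: "theta \<noteq> 0" "negX theta \<noteq> 0" "powX 4 theta \<noteq> 0"
  by (metis theta_nth_0 fps_compose_nth_0 fps_zero_nth zero_neq_one)+

lemma negX_Phi2_theta: "negX Phi2 * theta = 1"
proof -
  have "Phi2 * negX theta * euler 1 ^ 2 = (Phi2 * euler 1 ^ 2) * negX theta"
    by (simp only: ac_simps)
  also have "\<dots> = 1 * euler 1 ^ 2"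
    unfolding Phi2_eta mult.commute[of "euler 2"] theta_product by simp
  finally have "Phi2 * negX theta = 1"
    unfolding mult_cancel_right using euler_nonzero[of 1] by simp
  then show ?thesis
    using negX_simps(1)[of Phi2 "negX theta"] by simp
qed

lemma theta_euler: "theta * euler 1 ^ 2 * euler 4 ^ 2 = euler 2 ^ 5"
proof -
  have t: "theta * euler 2 = negX (euler 1) ^ 2"
    using arg_cong[OF theta_product, of negX] by (simp add: negX_euler_2)
  have "(theta * euler 1 ^ 2 * euler 4 ^ 2) * euler 2 = (negX (euler 1) * euler 1 * euler 4) ^ 2"
    unfolding power_mult_distrib t[symmetric] by (simp add: ac_simps)
  also have "\<dots> = euler 2 ^ 5 * euler 2"
    unfolding negX_euler by (simp flip: power_mult power_Suc2)
  finally show ?thesis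
    using euler_nonzero[of 2] by simp
qed

text \<open>Both sides are quotients of the series \<open>E(q\<^sup>j)\<close>, as \<open>\<phi>(-q) = E(q)\<^sup>2 / E(q\<^sup>2)\<close> and
  \<open>\<phi>(q) = E(q\<^sup>2)\<^sup>5 / (E(q)\<^sup>2 E(q\<^sup>4)\<^sup>2)\<close>. Together with the value of \<open>\<phi>(q)\<^sup>2 + \<phi>(-q)\<^sup>2\<close> below, this is a
  step of the arithmetic-geometric mean.\<close>

lemma theta_mult_negX: "theta * negX theta = powX 2 (negX theta) ^ 2"
proof -
  have N: "negX theta * euler 2 = euler 1 ^ 2"
    by (rule theta_product)
  have N2: "powX 2 (negX theta) * euler 4 = euler 2 ^ 2"
    using arg_cong[OF theta_product, of "powX 2"] by (simp add: powX_simps powX_euler)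
  have "theta * negX theta * (euler 2 * euler 4 ^ 2) = theta * euler 1 ^ 2 * euler 4 ^ 2"
    unfolding N[symmetric] by (simp add: ac_simps)
  also have "\<dots> = euler 2 * (euler 2 ^ 2) ^ 2"
    unfolding theta_euler by (simp flip: power_mult power_Suc)
  also have "\<dots> = powX 2 (negX theta) ^ 2 * (euler 2 * euler 4 ^ 2)"
    unfolding N2[symmetric] by (simp add: power_mult_distrib ac_simps)
  finally show ?thesis
    using euler_nonzero[of 2] euler_nonzero[of 4] by simp
qed

lemma fps_numeral_mult_nth: "(numeral k * f) $ n = numeral k * (f :: int fps) $ n"
  by (simp add: numeral_fps_const)

text \<open>The even squares are the squares times 4.\<close>

lemma theta_add_negX: "theta + negX theta = 2 * powX 4 theta"
proof (rule fps_ext)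
  fix n :: nat
  consider "odd n" | m where "n = 4 * m" | "even n" "\<not> 4 dvd n"
    by (metis dvdE)
  then show "(theta + negX theta) $ n = (2 * powX 4 theta) $ n"
  proof cases
    case 1
    then have "\<not> 4 dvd n" by presburger
    with 1 show ?thesis
      by (simp add: negX_nth fps_numeral_mult_nth powX_nth)
  next
    case (2 m)
    have "(\<exists>k. 4 * m = k ^ 2) \<longleftrightarrow> (\<exists>k. m = k ^ 2)"
    proof safe
      fix k assume k: "4 * m = k ^ 2"
      then have "even (k ^ 2)" by (metis dvd_mult2 even_numeral)
      then obtain l where "k = 2 * l" by (auto elim: evenE)
      with k show "\<exists>k. m = k ^ 2" by (auto simp: power_mult_distrib)
    next
      fix k :: nat show "\<exists>l. 4 * k ^ 2 = l ^ 2" by (rule exI[of _ "2 * k"]) (simp add: power_mult_distrib)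
    qed
    with 2 show ?thesis
      by (simp add: negX_nth fps_numeral_mult_nth powX_nth theta_def)
  next
    case 3
    have "n \<noteq> k ^ 2" for k
    proof
      assume k: "n = k ^ 2"
      then obtain l where "k = 2 * l" using 3 by (auto elim: evenE)
      with k 3 show False by (simp add: power_mult_distrib)
    qed
    moreover from this[of 0] have "n \<noteq> 0" by simp
    ultimately show ?thesis
      using 3 by (auto simp: negX_nth fps_numeral_mult_nth powX_nth theta_def)
  qed
qed

lemma eq_0_if_dilation:
  fixes f :: "int fps"
  assumes "f = - 2 * powX 2 f"
  shows "f = 0"
proof -
  have n: "f $ n = - 2 * powX 2 f $ n" for n
    using arg_cong[OF assms, of "\<lambda>g. g $ n"] by (simp add: fps_numeral_mult_nth)
  have "f $ n = 0" for n
  proof (induction n rule: less_induct)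
    case (less n)
    show ?case
      using n[of n] less[of "n div 2"] by (cases "n = 0") (auto simp: powX_nth split: if_splits)
  qed
  then show ?thesis by (simp add: fps_eq_iff)
qed

text \<open>Let \<open>D(q)\<close> be the difference of the two sides. Squaring \<open>\<phi>(q) + \<phi>(-q) = 2\<phi>(q\<^sup>4)\<close> and using
  \<open>\<phi>(q)\<phi>(-q) = \<phi>(-q\<^sup>2)\<^sup>2\<close> gives \<open>D(q) = -2D(q\<^sup>2)\<close>, and a power series with this property
  vanishes.\<close>

lemma theta_square_add: "theta ^ 2 + negX theta ^ 2 = 2 * powX 2 theta ^ 2"
proof -
  define D where "D = theta ^ 2 + negX theta ^ 2 - 2 * powX 2 theta ^ 2"
  have D2: "powX 2 D = powX 2 theta ^ 2 + powX 2 (negX theta) ^ 2 - 2 * powX 4 theta ^ 2"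
    unfolding D_def by (simp add: powX_simps powX_powX)
  have "theta ^ 2 + negX theta ^ 2 + 2 * (theta * negX theta) = (theta + negX theta) ^ 2"
    by (simp add: power2_eq_square algebra_simps)
  also have "\<dots> = 4 * powX 4 theta ^ 2"
    unfolding theta_add_negX by (simp add: power_mult_distrib)
  finally have "D = - 2 * powX 2 D"
    unfolding D2 unfolding D_def theta_mult_negX by (simp add: algebra_simps)
  then show ?thesis
    using eq_0_if_dilation[of D] unfolding D_def by simp
qed

text \<open>The series \<open>\<psi>(q) = \<Sum>q\<^bsup>n(n+1)/2\<^esup>\<close> over \<open>n \<ge> 0\<close>: a number \<open>m\<close> is triangular iff \<open>8m + 1\<close> is
  a square.\<close>

definition psi :: "int fps" where
  "psi = Abs_fps (\<lambda>n. if \<exists>k. 8 * n + 1 = k ^ 2 then 1 else 0)"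

lemma psi_nth_0 [simp]: "psi $ 0 = 1"
  by (auto simp: psi_def intro: exI[of _ 1])

lemma odd_square_mod_8:
  fixes k :: nat
  assumes "odd k"
  shows "k ^ 2 mod 8 = 1"
proof -
  obtain l where l: "k = 2 * l + 1" using assms by (rule oddE)
  obtain t where "l * (l + 1) = 2 * t" by (meson even_mult_iff even_plus_one_iff dvdE)
  then have "k ^ 2 = 8 * t + 1"
    unfolding l by (simp add: power2_eq_square algebra_simps)
  then show ?thesis by simp
qed

text \<open>Odd squares are 1 modulo 8.\<close>

lemma theta_diff_negX: "theta - negX theta = 4 * fps_X * powX 8 psi"
proof (rule fps_ext)
  fix n
  have R: "(4 * fps_X * powX 8 psi) $ n = 4 * (if n = 0 then 0 else powX 8 psi $ (n - 1))"
    unfolding mult.assoc fps_numeral_mult_nth by simp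
  show "(theta - negX theta) $ n = (4 * fps_X * powX 8 psi) $ n"
  proof (cases "n mod 8 = 1")
    case True
    then obtain m where m: "n = 8 * m + 1"
      by (metis mult_div_mod_eq)
    show ?thesis
      unfolding R unfolding m by (simp add: negX_nth powX_nth theta_def psi_def)
  next
    case False
    have "(theta - negX theta) $ n = 0"
    proof (cases "even n")
      case False
      then have "n \<noteq> k ^ 2" for k
        using odd_square_mod_8[of k] \<open>n mod 8 \<noteq> 1\<close> by auto
      moreover have "n \<noteq> 0" using False by presburger
      ultimately show ?thesis by (auto simp: theta_def negX_nth)
    qed (simp add: negX_nth)
    moreover have "n > 0 \<Longrightarrow> \<not> 8 dvd (n - 1)"
      using False by presburger
    ultimately show ?thesis
      unfolding R by (auto simp: powX_nth)
  qed
qed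

text \<open>After \<open>q \<mapsto> q\<^sup>8\<close> and multiplication by \<open>16q\<^sup>2\<close>, both sides become \<open>(\<phi>(q) - \<phi>(-q))\<^sup>2\<close>, by the
  relations for \<open>\<phi>(q)\<phi>(-q)\<close> and \<open>\<phi>(q)\<^sup>2 + \<phi>(-q)\<^sup>2\<close>.\<close>

lemma psi_square: "psi ^ 2 = theta * powX 2 psi"
proof -
  have "16 * fps_X ^ 2 * powX 8 (psi ^ 2) = (theta - negX theta) ^ 2"
    unfolding theta_diff_negX by (simp add: powX_simps power_mult_distrib)
  also have "\<dots> = (theta ^ 2 + negX theta ^ 2) - 2 * (theta * negX theta)"
    by (simp add: power2_eq_square algebra_simps)
  also have "\<dots> = 2 * (powX 2 (theta + negX theta) * powX 2 (theta - negX theta))"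
  proof -
    have "(a + b) * (a - b) = a ^ 2 - b ^ 2" for a b :: "int fps"
      by (simp add: power2_eq_square algebra_simps)
    then show ?thesis
      unfolding theta_square_add theta_mult_negX by (simp add: powX_simps)
  qed
  also have "\<dots> = 16 * fps_X ^ 2 * powX 8 (theta * powX 2 psi)"
    unfolding theta_add_negX theta_diff_negX by (simp add: powX_simps powX_powX)
  finally have "powX 8 (psi ^ 2) = powX 8 (theta * powX 2 psi)"
    by simp
  then show ?thesis
    by (rule powX_inj[rotated]) simp
qed

text \<open>For \<open>r = f / g\<close> the equation reads \<open>r(q)\<^sup>2 = r(q\<^sup>2)\<close>, and the constant term of \<open>r\<close> is 1. If
  \<open>r = 1 + c q\<^sup>n + \<dots>\<close> with \<open>c \<noteq> 0\<close>, then \<open>r(q)\<^sup>2 - 1\<close> has order \<open>n\<close>, but \<open>r(q\<^sup>2) - 1\<close> has order \<open>2n\<close>. The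
  proof measures these orders on \<open>d = f - g\<close>, which avoids the division.\<close>

lemma eq_if_square_dilation:
  fixes f g :: "int fps"
  assumes "f $ 0 = 1" "g $ 0 = 1" and eq: "f ^ 2 * powX 2 g = g ^ 2 * powX 2 f"
  shows "f = g"
proof (rule ccontr)
  assume "f \<noteq> g"
  define d where "d = f - g"
  define n where "n = subdegree d"
  have "d \<noteq> 0" "d $ 0 = 0" using \<open>f \<noteq> g\<close> assms by (simp_all add: d_def)
  then have "n > 0" unfolding n_def by (metis nth_subdegree_nonzero not_gr_zero)
  have e: "d * ((f + g) * powX 2 g) = g ^ 2 * powX 2 d"
    unfolding d_def powX_simps(3)[OF zero_less_numeral] using eq
    by (simp add: power2_eq_square algebra_simps)
  have "((f + g) * powX 2 g) $ 0 = 2" "(g ^ 2) $ 0 = 1"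
    using assms by (simp_all add: fps_power_zeroth)
  then have s: "subdegree ((f + g) * powX 2 g) = 0" "subdegree (g ^ 2) = 0"
    and z: "(f + g) * powX 2 g \<noteq> 0" "g ^ 2 \<noteq> 0"
    by (metis subdegree_eq_0 zero_neq_numeral zero_neq_one fps_zero_nth)+
  have "powX 2 d \<noteq> 0"
    using \<open>d \<noteq> 0\<close> powX_inj[of 2 d 0] by auto
  have "n + 0 = 0 + n * 2"
    using arg_cong[OF e, of subdegree] z \<open>powX 2 d \<noteq> 0\<close> \<open>d \<noteq> 0\<close> s
    by (simp add: n_def)
  with \<open>n > 0\<close> show False by simp
qed

text \<open>Both \<open>\<psi>(q)\<close> and \<open>E(q\<^sup>2)\<^sup>2 / E(q)\<close> solve \<open>f(q)\<^sup>2 = \<phi>(q) f(q\<^sup>2)\<close>, and the solution with constant term 1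
  is unique. So the product for \<open>\<psi>\<close> comes from the one for \<open>\<phi>\<close>.\<close>

lemma psi_euler: "euler 1 * psi = euler 2 ^ 2"
proof (rule eq_if_square_dilation)
  have "(euler 1 * psi) ^ 2 * powX 2 (euler 2 ^ 2) = (theta * euler 1 ^ 2 * euler 4 ^ 2) * powX 2 psi"
    by (simp add: power_mult_distrib psi_square powX_simps powX_euler ac_simps)
  also have "\<dots> = (euler 2 ^ 2) ^ 2 * powX 2 (euler 1 * psi)"
    unfolding theta_euler by (simp add: powX_simps powX_euler mult.assoc flip: power_mult power_Suc2)
  finally show "(euler 1 * psi) ^ 2 * powX 2 (euler 2 ^ 2) = (euler 2 ^ 2) ^ 2 * powX 2 (euler 1 * psi)" .
qed (simp_all add: euler_nth_0 fps_power_zeroth)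

lemma theta_square_diff: "theta ^ 2 - negX theta ^ 2 = 8 * fps_X * powX 4 psi ^ 2"
proof -
  have "theta ^ 2 - negX theta ^ 2 = (theta + negX theta) * (theta - negX theta)"
    by (simp add: power2_eq_square algebra_simps)
  also have "\<dots> = 8 * fps_X * powX 4 (theta * powX 2 psi)"
    unfolding theta_add_negX theta_diff_negX by (simp add: powX_simps powX_powX)
  finally show ?thesis
    unfolding psi_square [symmetric] by (simp add: powX_simps)
qed

text \<open>Both \<open>G8\<close> and \<open>G2\<close> are rational functions of \<open>\<phi>(q)\<close> and \<open>\<phi>(-q)\<close>, as the eta quotients show
  \<open>G8 = q \<psi>(q\<^sup>4)\<^sup>2 / \<phi>(-q)\<^sup>2\<close> and \<open>G2 = q \<psi>(q)\<^sup>8 / \<phi>(-q)\<^sup>8\<close>.\<close>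

lemma G8_theta: "8 * G8 * negX theta ^ 2 = theta ^ 2 - negX theta ^ 2"
proof -
  have p: "euler 4 * powX 4 psi = euler 8 ^ 2"
    using arg_cong[OF psi_euler, of "powX 4"] by (simp add: powX_simps powX_euler)
  have "G8 * negX theta ^ 2 * (euler 4 ^ 2 * euler 2 ^ 2)
      = G8 * (euler 4 ^ 2 * (negX theta * euler 2) ^ 2)"
    by (simp add: power_mult_distrib ac_simps)
  also have "\<dots> = G8 * (euler 4 ^ 2 * euler 1 ^ 4)"
    unfolding theta_product by (simp flip: power_mult)
  also have "\<dots> = fps_X * ((euler 8 ^ 2) ^ 2 * euler 2 ^ 2)"
    unfolding G8_eta by (simp flip: power_mult)
  also have "\<dots> = fps_X * powX 4 psi ^ 2 * (euler 4 ^ 2 * euler 2 ^ 2)"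
    unfolding p [symmetric] by (simp add: power_mult_distrib ac_simps)
  finally have "G8 * negX theta ^ 2 = fps_X * powX 4 psi ^ 2"
    using euler_nonzero[of 4] euler_nonzero[of 2] by simp
  then show ?thesis
    unfolding theta_square_diff by (simp add: mult.assoc)
qed

lemma G2_theta: "16 * G2 * negX theta ^ 8 = theta ^ 4 * (theta ^ 4 - negX theta ^ 4)"
proof -
  have "G2 * negX theta ^ 8 * (euler 1 ^ 8 * euler 2 ^ 8) = G2 * (euler 1 ^ 8 * (negX theta * euler 2) ^ 8)"
    by (simp add: power_mult_distrib ac_simps)
  also have "\<dots> = G2 * euler 1 ^ 24"
    unfolding theta_product by (simp flip: power_mult power_add)
  also have "\<dots> = fps_X * ((euler 2 ^ 2) ^ 8 * euler 2 ^ 8)"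
    unfolding G2_eta by (simp flip: power_mult power_add)
  also have "\<dots> = fps_X * psi ^ 8 * (euler 1 ^ 8 * euler 2 ^ 8)"
    unfolding psi_euler [symmetric] by (simp add: power_mult_distrib ac_simps)
  finally have G2: "G2 * negX theta ^ 8 = fps_X * psi ^ 8"
    using euler_nonzero[of 1] euler_nonzero[of 2] by simp
  have "(theta * powX 2 psi) ^ 4 = (psi ^ 2) ^ 4"
    by (simp only: psi_square)
  then have psi8: "psi ^ 8 = theta ^ 4 * (powX 2 psi ^ 2) ^ 2"
    by (simp add: power_mult_distrib flip: power_mult)
  have psi2: "powX 2 psi ^ 2 = powX 2 theta * powX 4 psi"
    using arg_cong[OF psi_square, of "powX 2"] by (simp add: powX_simps powX_powX)
  have "16 * G2 * negX theta ^ 8 = theta ^ 4 * ((2 * powX 2 theta ^ 2) * (8 * fps_X * powX 4 psi ^ 2))"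
    using G2 unfolding psi8 psi2 by (simp add: power_mult_distrib ac_simps)
  also have "\<dots> = theta ^ 4 * (theta ^ 4 - negX theta ^ 4)"
    unfolding theta_square_add [symmetric] theta_square_diff [symmetric]
    by (simp add: algebra_simps flip: power_add)
  finally show ?thesis .
qed

section \<open>The quadratic equation of 4 G8 over the series in q^2\<close>

lemma theta_2_square: "powX 2 theta ^ 2 + powX 2 (negX theta) ^ 2 = 2 * powX 4 theta ^ 2"
  using arg_cong[OF theta_square_add, of "powX 2"] by (simp add: powX_simps powX_powX)

lemma G8_0 [simp]: "G8 $ 0 = 0" by (rule G8_nth_0)

lemma negX_G8_theta: "8 * negX G8 * theta ^ 2 = negX theta ^ 2 - theta ^ 2"
  using arg_cong[OF G8_theta, of negX] by simp

lemma powX_G8_theta: "8 * powX 2 G8 * powX 2 (negX theta) ^ 2 = powX 2 theta ^ 2 - powX 2 (negX theta) ^ 2"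
  using arg_cong[OF G8_theta, of "powX 2"] by (simp add: powX_simps)

text \<open>The elimination behind the trace and the norm of \<open>G8\<close>. It is stated for arbitrary elements, with
  \<open>p\<close>, \<open>m\<close> for \<open>\<phi>(\<plusminus>q)\<close>, \<open>p2\<close>, \<open>m2\<close> for \<open>\<phi>(\<plusminus>q\<^sup>2)\<close>, \<open>g\<close>, \<open>gm\<close> for \<open>G8(\<plusminus>q)\<close> and \<open>h\<close> for \<open>G8(q\<^sup>2)\<close>, so
  that it is a pure ideal membership problem. After multiplication by \<open>p\<^sup>2m\<^sup>2\<close> both claims reduce to
  \<open>(p\<^sup>2 - m\<^sup>2)\<^sup>2 = 64 (h + 4h\<^sup>2) p\<^sup>2m\<^sup>2\<close>.\<close>

lemma theta_root_relations:
  fixes p m p2 m2 g gm h :: "int fps"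
  assumes "p \<noteq> 0" "m \<noteq> 0" and "p * m = m2 ^ 2" "p ^ 2 + m ^ 2 = 2 * p2 ^ 2" "8 * g * m ^ 2 = p ^ 2 - m ^ 2"
    "8 * gm * p ^ 2 = m ^ 2 - p ^ 2" "8 * h * m2 ^ 2 = p2 ^ 2 - m2 ^ 2"
  shows "g + gm = 8 * (h + 4 * h ^ 2)" "g * gm = - (h + 4 * h ^ 2)"
proof -
  have "8 * p ^ 2 * m ^ 2 * (g + gm) = 8 * p ^ 2 * m ^ 2 * (8 * (h + 4 * h ^ 2))"
    using assms(3-) by algebra
  then show "g + gm = 8 * (h + 4 * h ^ 2)"
    using assms(1,2) by simp
  have "64 * p ^ 2 * m ^ 2 * (g * gm) = 64 * p ^ 2 * m ^ 2 * - (h + 4 * h ^ 2)"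
    using assms(3-) by algebra
  then show "g * gm = - (h + 4 * h ^ 2)"
    using assms(1,2) by simp
qed

text \<open>Powers of \<open>4 G8\<close> instead of \<open>G8\<close> account for the summand \<open>2j\<close> in the bounds: it remains to work
  with integral polynomials in \<open>Y\<close>.\<close>

definition Y :: "int fps" where
  "Y = 4 * G8"

text \<open>The trace and the norm of \<open>Y\<close> over the series in \<open>q\<^sup>2\<close> are \<open>8K(q\<^sup>2)\<close> and \<open>-4K(q\<^sup>2)\<close>.\<close>

definition K :: "int fps" where
  "K = Y + Y ^ 2"

lemma Y_0 [simp]: "Y $ 0 = 0"
  by (simp add: Y_def)

lemma powX_K: "powX 2 K = 4 * (powX 2 G8 + 4 * powX 2 G8 ^ 2)"
  by (simp add: K_def Y_def powX_simps power_mult_distrib)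

lemmas theta_facts = theta_nonzero(1,2) theta_mult_negX theta_square_add G8_theta negX_G8_theta powX_G8_theta

lemma Y_quadratic:
  assumes "y \<in> {Y, negX Y}"
  shows "y ^ 2 = y * powX 2 (8 * K) + powX 2 (4 * K)"
proof -
  have "(y - Y) * (y - negX Y) = 0"
    using assms by auto
  moreover have "Y + negX Y = 8 * powX 2 K" "Y * negX Y = - (4 * powX 2 K)"
    unfolding powX_K using theta_root_relations[OF theta_facts]
    by (simp_all add: Y_def flip: distrib_left)
  ultimately have "y ^ 2 = y * (8 * powX 2 K) + 4 * powX 2 K"
    by algebra
  then show ?thesis
    by (simp add: powX_simps)
qed

section \<open>The operator U2\<close>

lemma U2_eqI: "f + negX f = 2 * powX 2 g \<Longrightarrow> U2 f = g"
proof (rule fps_ext)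
  fix n
  assume "f + negX f = 2 * powX 2 g"
  then have "(f + negX f) $ (2 * n) = (2 * powX 2 g) $ (2 * n)"
    by (rule arg_cong)
  then show "U2 f $ n = g $ n"
    by (simp add: U2_def negX_nth fps_numeral_mult_nth powX_nth)
qed

lemma powX_U2: "f + negX f = 2 * powX 2 (U2 f)"
  by (rule fps_ext) (auto simp: U2_def negX_nth fps_numeral_mult_nth powX_nth)

text \<open>\<open>U2\<close> takes the even part and replaces \<open>q\<^sup>2\<close> by \<open>q\<close>; series in \<open>q\<^sup>2\<close> are its scalars.\<close>

lemma U2_mult_powX: "U2 (f * powX 2 h) = U2 f * h"
proof (rule U2_eqI)
  have "f * powX 2 h + negX (f * powX 2 h) = (f + negX f) * powX 2 h"
    by (simp add: negX_powX algebra_simps)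
  then show "f * powX 2 h + negX (f * powX 2 h) = 2 * powX 2 (U2 f * h)"
    unfolding powX_U2 by (simp add: powX_simps)
qed

lemma U2_add: "U2 (f + g) = U2 f + U2 g"
  by (simp add: U2_def fps_eq_iff)

lemma U2_sum: "U2 (\<Sum>i\<in>A. f i) = (\<Sum>i\<in>A. U2 (f i))"
  by (simp add: U2_def fps_eq_iff fps_sum_nth)

lemma U2_const_mult: "U2 (fps_const c * f) = fps_const c * U2 f"
  by (simp add: U2_def fps_eq_iff)

lemma U2_two_power_mult: "U2 (2 ^ n * f) = 2 ^ n * U2 f"
  using U2_const_mult[of "2 ^ n" f] by (simp add: numeral_fps_const)

abbreviation (input) Phi :: "int fps" where
  "Phi \<equiv> negX Phi2"

text \<open>The traces \<open>F(q) + F(-q)\<close> of \<open>F = \<Phi>, \<Phi> Y(q), \<Phi> Y(-q)\<close> with \<open>\<Phi> = 1 / \<phi>(q)\<close>, in the notation of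
  \<open>theta_root_relations\<close>; moreover \<open>a\<close>, \<open>b\<close>, \<open>c\<close> are the inverses of \<open>\<phi>(q)\<close>, \<open>\<phi>(-q)\<close> and
  \<open>p4 = \<phi>(q\<^sup>4)\<close>. The third trace uses \<open>p\<^sup>2 + m\<^sup>2 + p m = (3 + 16h) p m\<close>.\<close>

lemma Phi_trace_relations:
  fixes a b c p m p2 m2 p4 g gm h :: "int fps"
  assumes nz: "p \<noteq> 0" "m \<noteq> 0" "p4 \<noteq> 0"
    and inv: "a * p = 1" "b * m = 1" "c * p4 = 1"
    and eqs: "p * m = m2 ^ 2" "p + m = 2 * p4" "p2 ^ 2 + m2 ^ 2 = 2 * p4 ^ 2"
      "p ^ 2 + m ^ 2 = 2 * p2 ^ 2"
      "8 * g * m ^ 2 = p ^ 2 - m ^ 2" "8 * gm * p ^ 2 = m ^ 2 - p ^ 2" "8 * h * m2 ^ 2 = p2 ^ 2 - m2 ^ 2"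
  shows "a + b = 2 * (c * (1 + 4 * h))"
    and "a * (4 * g) + b * (4 * gm) = 2 * (c * (2 * (4 * (h + 4 * h ^ 2))))"
    and "a * (4 * gm) + b * (4 * g) = 2 * (c * (2 * (4 * (h + 4 * h ^ 2)) * (3 + 4 * (4 * h))))"
proof -
  have "p * m * p4 * (a + b) = p4 * (p + m)"
    using inv by algebra
  also have "\<dots> = p * m * p4 * (2 * (c * (1 + 4 * h)))"
    using inv eqs by algebra
  finally show "a + b = 2 * (c * (1 + 4 * h))"
    using nz by simp
  have D: "(p ^ 2 - m ^ 2) ^ 2 = 64 * (h + 4 * h ^ 2) * (p * m) ^ 2"
    using eqs by algebra
  have "p * m * p4 * (a * (4 * g) + b * (4 * gm)) = p4 * (4 * g * m + 4 * gm * p)"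
    using inv by algebra
  moreover have "4 * p ^ 2 * m ^ 2 * (p4 * (4 * g * m + 4 * gm * p))
      = (2 * p4) * ((8 * g * m ^ 2) * p ^ 2 * m + (8 * gm * p ^ 2) * m ^ 2 * p)"
    by algebra
  moreover have "\<dots> = p * m * (p ^ 2 - m ^ 2) ^ 2"
    unfolding eqs(5,6) eqs(2)[symmetric] by algebra
  moreover have "p * m * p4 * (2 * (c * (2 * (4 * (h + 4 * h ^ 2))))) = 16 * (p * m) * (h + 4 * h ^ 2)"
    using inv(3) by algebra
  ultimately have "4 * p ^ 2 * m ^ 2 * (p * m * p4) * (a * (4 * g) + b * (4 * gm))
      = 4 * p ^ 2 * m ^ 2 * (p * m * p4) * (2 * (c * (2 * (4 * (h + 4 * h ^ 2)))))"
    using D by algebra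
  then show "a * (4 * g) + b * (4 * gm) = 2 * (c * (2 * (4 * (h + 4 * h ^ 2))))"
    unfolding mult_cancel_left using nz by simp
  have "p * m * p4 * (a * (4 * gm) + b * (4 * g)) = p4 * (4 * gm * m + 4 * g * p)"
    using inv by algebra
  moreover have "4 * p ^ 2 * m ^ 2 * (p4 * (4 * gm * m + 4 * g * p))
      = (2 * p4) * ((8 * gm * p ^ 2) * m ^ 3 + (8 * g * m ^ 2) * p ^ 3)"
    by algebra
  moreover have "\<dots> = (p ^ 2 - m ^ 2) ^ 2 * (p ^ 2 + m ^ 2 + p * m)"
    unfolding eqs(5,6) eqs(2)[symmetric] by algebra
  moreover have "p ^ 2 + m ^ 2 + p * m = (3 + 16 * h) * (p * m)"
    using eqs(1,4,7) by algebra
  moreover have "p * m * p4 * (2 * (c * (2 * (4 * (h + 4 * h ^ 2)) * (3 + 4 * (4 * h)))))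
      = 16 * (p * m) * (h + 4 * h ^ 2) * (3 + 16 * h)"
    using inv(3) by algebra
  ultimately have "4 * p ^ 2 * m ^ 2 * (p * m * p4) * (a * (4 * gm) + b * (4 * g))
      = 4 * p ^ 2 * m ^ 2 * (p * m * p4) *
        (2 * (c * (2 * (4 * (h + 4 * h ^ 2)) * (3 + 4 * (4 * h)))))"
    using D by algebra
  then show "a * (4 * gm) + b * (4 * g) = 2 * (c * (2 * (4 * (h + 4 * h ^ 2)) * (3 + 4 * (4 * h))))"
    unfolding mult_cancel_left using nz by simp
qed

lemma U2_Phi:
  shows "U2 Phi = powX 2 Phi * (1 + Y)"
    and "U2 (Phi * Y) = powX 2 Phi * (2 * K)"
    and "U2 (Phi * negX Y) = powX 2 Phi * (2 * K * (3 + 4 * Y))"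
proof -
  have i: "negX Phi2 * theta = 1" "Phi2 * negX theta = 1" "powX 4 (negX Phi2) * powX 4 theta = 1"
    using negX_Phi2_theta arg_cong[OF negX_Phi2_theta, of negX] arg_cong[OF negX_Phi2_theta, of "powX 4"]
    unfolding powX_simps(1)[OF zero_less_numeral] negX_simps(1) negX_negX fps_compose_1 .
  note facts = Phi_trace_relations[OF theta_nonzero i theta_mult_negX theta_add_negX
    theta_2_square theta_square_add G8_theta negX_G8_theta powX_G8_theta]
  show "U2 Phi = powX 2 Phi * (1 + Y)"
    by (rule U2_eqI) (use facts(1) in \<open>simp add: powX_simps powX_powX Y_def\<close>)
  show "U2 (Phi * Y) = powX 2 Phi * (2 * K)"
    by (rule U2_eqI) (use facts(2) in \<open>simp add: powX_simps powX_powX powX_K, simp add: Y_def\<close>)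
  show "U2 (Phi * negX Y) = powX 2 Phi * (2 * K * (3 + 4 * Y))"
    by (rule U2_eqI) (use facts(3) in \<open>simp add: powX_simps powX_powX powX_K, simp add: Y_def powX_simps\<close>)
qed

lemma U2_1: "U2 1 = 1" and U2_Y: "U2 Y = 4 * K"
proof -
  show "U2 1 = 1" by (rule U2_eqI) simp
  show "U2 Y = 4 * K"
  proof (rule U2_eqI)
    show "Y + negX Y = 2 * powX 2 (4 * K)"
      using theta_root_relations(1)[OF theta_facts] 
      by (simp add: powX_simps powX_K) (simp add: Y_def flip: distrib_left)
  qed
qed

text \<open>Since \<open>\<phi>(-q)\<^sup>2 / \<phi>(q)\<^sup>2 = 1 + 2Y(-q)\<close>, the expression of \<open>G2(-q)\<close> by theta series becomes a polynomial
  in \<open>Y(-q)\<close>. The factor 4 on the left is the source of the loss \<open>s\<close> in the bounds.\<close>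

lemma G2_negX: "4 * negX G2 = negX Y * ((1 + 2 * negX Y) ^ 2 * (1 + negX Y))"
proof -
  have "16 * negX G2 * theta ^ 8 = negX theta ^ 4 * (negX theta ^ 4 - theta ^ 4)"
    using arg_cong[OF G2_theta, of negX] by simp
  moreover have "negX theta ^ 2 = (1 + 8 * negX G8) * theta ^ 2"
    using negX_G8_theta by algebra
  ultimately have "theta ^ 8 * (16 * negX G2) = theta ^ 8 * (16 * (negX G8 * ((1 + 8 * negX G8) ^ 2 * (1 + 4 * negX G8))))"
    by algebra
  then show ?thesis
    using theta_nonzero(1) by (simp add: Y_def)
qed

section \<open>Divisibility by powers of 2\<close>

definition int_polys :: "int fps \<Rightarrow> int fps set" where
  "int_polys y = range (\<lambda>p. fps_of_poly p oo y)"

lemma int_polys_intros: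
  assumes "y $ 0 = 0"
  shows "1 \<in> int_polys y" "y \<in> int_polys y" "fps_const c \<in> int_polys y"
    and "f \<in> int_polys y \<Longrightarrow> g \<in> int_polys y \<Longrightarrow> f + g \<in> int_polys y"
    and "f \<in> int_polys y \<Longrightarrow> g \<in> int_polys y \<Longrightarrow> f * g \<in> int_polys y"
proof -
  show "1 \<in> int_polys y"
    unfolding int_polys_def by (rule range_eqI[of _ _ 1]) simp
  show "y \<in> int_polys y"
    unfolding int_polys_def by (rule range_eqI[of _ _ "[:0, 1:]"]) (simp add: assms)
  show "fps_const c \<in> int_polys y"
    unfolding int_polys_def by (rule range_eqI[of _ _ "[:c:]"]) (simp add: fps_of_poly_const)
  assume "f \<in> int_polys y" "g \<in> int_polys y"
  then obtain p q where pq: "f = fps_of_poly p oo y" "g = fps_of_poly q oo y"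
    unfolding int_polys_def by blast
  show "f + g \<in> int_polys y"
    unfolding int_polys_def
    by (rule range_eqI[of _ _ "p + q"]) (simp add: pq fps_of_poly_add fps_compose_add_distrib)
  show "f * g \<in> int_polys y"
    unfolding int_polys_def
    by (rule range_eqI[of _ _ "p * q"])
       (simp add: pq fps_of_poly_mult fps_compose_mult_distrib assms)
qed

lemma int_polys_numeral: "y $ 0 = 0 \<Longrightarrow> numeral k \<in> int_polys y"
  unfolding numeral_fps_const by (rule int_polys_intros)

lemma int_polys_power: "y $ 0 = 0 \<Longrightarrow> f \<in> int_polys y \<Longrightarrow> f ^ n \<in> int_polys y"
  by (induction n) (auto intro: int_polys_intros)

lemma int_polys_sum:
  "y $ 0 = 0 \<Longrightarrow> (\<And>i. i \<in> A \<Longrightarrow> f i \<in> int_polys y) \<Longrightarrow> (\<Sum>i\<in>A. f i) \<in> int_polys y"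
  using int_polys_intros(3)[of y 0]
  by (induction A rule: infinite_finite_induct) (auto intro: int_polys_intros(4))

lemmas int_polys_closed = int_polys_intros int_polys_numeral int_polys_power int_polys_sum

lemma int_polys_expand:
  assumes "f \<in> int_polys y" "y $ 0 = 0"
  obtains c :: "nat \<Rightarrow> int" and d where "f = (\<Sum>i\<le>d. fps_const (c i) * y ^ i)"
proof -
  obtain p where p: "f = fps_of_poly p oo y"
    using assms(1) unfolding int_polys_def by blast
  have "fps_of_poly p = (\<Sum>i\<le>degree p. fps_const (coeff p i) * fps_X ^ i)"
    by (subst poly_as_sum_of_monoms[symmetric]) (simp only: fps_of_poly_sum fps_of_poly_monom)
  then have "f = (\<Sum>i\<le>degree p. fps_const (coeff p i) * y ^ i)"
    unfolding p by (simp add: fps_compose_sum_distrib compose_ring_simps assms)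
  then show thesis by (rule that)
qed

text \<open>By the quadratic equation of \<open>y\<close>, the series \<open>u\<^sub>j = U2 (F y\<^sup>j)\<close> satisfy
  \<open>u\<^sub>j\<^sub>+\<^sub>2 = 8K u\<^sub>j\<^sub>+\<^sub>1 + 4K u\<^sub>j\<close>. The coefficient 4 supplies the two factors 2 that separate
  \<open>u\<^sub>j\<close> from \<open>u\<^sub>j\<^sub>+\<^sub>2\<close>, and \<open>K\<close> is a multiple of \<open>Y\<close>.\<close>

lemma U2_power:
  assumes y: "y \<in> {Y, negX Y}"
    and 0: "U2 F = C * r0" "r0 \<in> int_polys Y"
    and 1: "U2 (F * y) = C * (2 * Y * r1)" "r1 \<in> int_polys Y"
  shows "\<exists>r\<in>int_polys Y. U2 (F * y ^ Suc j) = C * (2 ^ Suc j * Y * r)"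
proof -
  note closed = int_polys_closed[OF Y_0]
  have K: "K = Y * (1 + Y)"
    by (simp add: K_def power2_eq_square algebra_simps)
  have rec: "U2 (F * y ^ Suc (Suc j)) = U2 (F * y ^ Suc j) * (8 * K) + U2 (F * y ^ j) * (4 * K)" for j
  proof -
    have "F * y ^ Suc (Suc j) = (F * y ^ j) * y ^ 2"
      by (simp add: power2_eq_square ac_simps)
    also have "\<dots> = (F * y ^ Suc j) * powX 2 (8 * K) + (F * y ^ j) * powX 2 (4 * K)"
      unfolding Y_quadratic[OF y] by (simp add: algebra_simps)
    finally show ?thesis
      by (simp only: U2_add U2_mult_powX)
  qed
  \<comment> \<open>The weaker claim, without the factor \<open>Y\<close>, is what also holds for \<open>j = 0\<close>.\<close>
  have "(\<exists>r\<in>int_polys Y. U2 (F * y ^ j) = C * (2 ^ j * r)) \<and>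
    (\<exists>r\<in>int_polys Y. U2 (F * y ^ Suc j) = C * (2 ^ Suc j * Y * r))"
  proof (induction j)
    case 0
    show ?case using assms by auto
  next
    case (Suc j)
    then obtain r r' where r: "r \<in> int_polys Y" "U2 (F * y ^ j) = C * (2 ^ j * r)"
      and r': "r' \<in> int_polys Y" "U2 (F * y ^ Suc j) = C * (2 ^ Suc j * Y * r')"
      by blast
    have "U2 (F * y ^ Suc (Suc j)) = C * (2 ^ Suc (Suc j) * Y * (4 * (Y * r') * (1 + Y) + r * (1 + Y)))"
      unfolding rec r(2) r'(2) K by (simp add: algebra_simps)
    moreover have "4 * (Y * r') * (1 + Y) + r * (1 + Y) \<in> int_polys Y" "Y * r' \<in> int_polys Y"
      by (intro closed r(1) r'(1))+
    ultimately show ?case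
      using r'(2) by (metis mult.assoc)
  qed
  then show ?thesis by blast
qed

text \<open>By linearity in \<open>f\<close>: only the powers \<open>y\<^sup>j\<close> with \<open>j \<ge> m\<close> occur in \<open>y\<^sup>m f\<close>.\<close>

lemma U2_int_polys:
  assumes y: "y \<in> {Y, negX Y}"
    and 0: "U2 F = C * r0" "r0 \<in> int_polys Y"
    and 1: "U2 (F * y) = C * (2 * Y * r1)" "r1 \<in> int_polys Y"
    and f: "f \<in> int_polys y" and m: "m \<ge> 1"
  shows "\<exists>r\<in>int_polys Y. U2 (F * (y ^ m * f)) = C * (2 ^ m * Y * r)"
proof -
  note closed = int_polys_closed[OF Y_0]
  have "y $ 0 = 0" using y by auto
  then obtain c d where fc: "f = (\<Sum>i\<le>d. fps_const (c i) * y ^ i)"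
    using int_polys_expand[OF f] by metis
  have "\<exists>r\<in>int_polys Y. U2 (F * y ^ (m + i)) = C * (2 ^ (m + i) * Y * r)" for i
    using U2_power[OF y 0 1, of "m + i - 1"] m by simp
  then obtain r where r: "\<And>i. r i \<in> int_polys Y" "\<And>i. U2 (F * y ^ (m + i)) = C * (2 ^ (m + i) * Y * r i)"
    by metis
  have "F * (y ^ m * f) = (\<Sum>i\<le>d. fps_const (c i) * (F * y ^ (m + i)))"
    unfolding fc sum_distrib_left by (intro sum.cong) (simp_all add: power_add ac_simps)
  then have "U2 (F * (y ^ m * f)) = (\<Sum>i\<le>d. fps_const (c i) * (C * (2 ^ (m + i) * Y * r i)))"
    by (simp only: U2_sum U2_const_mult r(2))
  also have "\<dots> = C * (2 ^ m * Y * (\<Sum>i\<le>d. fps_const (c i) * (2 ^ i * r i)))"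
    unfolding sum_distrib_left by (intro sum.cong) (simp_all add: power_add ac_simps)
  finally show ?thesis
    by (rule bexI) (intro closed r)
qed

lemma U2_Phi_int_polys:
  assumes y: "y \<in> {Y, negX Y}" and f: "f \<in> int_polys y" "m \<ge> 1"
  shows "\<exists>r\<in>int_polys Y. U2 (Phi * (y ^ m * f)) = powX 2 Phi * (2 ^ m * Y * r)"
proof -
  note closed = int_polys_closed[OF Y_0]
  have "\<exists>r\<in>int_polys Y. U2 (Phi * y) = powX 2 Phi * (2 * Y * r)"
  proof (cases "y = Y")
    case True
    have "U2 (Phi * y) = powX 2 Phi * (2 * Y * (1 + Y))"
      unfolding True U2_Phi by (simp add: K_def power2_eq_square algebra_simps)
    then show ?thesis by (rule bexI) (intro closed)
  next
    case False
    with y have y: "y = negX Y" by simp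
    have "U2 (Phi * y) = powX 2 Phi * (2 * Y * ((1 + Y) * (3 + 4 * Y)))"
      unfolding y U2_Phi by (simp add: K_def power2_eq_square algebra_simps)
    then show ?thesis by (rule bexI) (intro closed)
  qed
  then obtain r where r: "r \<in> int_polys Y" "U2 (Phi * y) = powX 2 Phi * (2 * Y * r)" by blast
  show ?thesis
    by (rule U2_int_polys[OF y U2_Phi(1) _ r(2,1) f]) (intro closed)
qed

lemma U2_powX_Phi_int_polys:
  assumes f: "f \<in> int_polys Y"
  shows "\<exists>r\<in>int_polys Y. U2 (powX 2 Phi * (Y * f)) = Phi * (2 * Y * r)"
proof -
  note closed = int_polys_closed[OF Y_0]
  have "U2 (1 * Y) = 1 * (2 * Y * (2 * (1 + Y)))"
    by (simp add: U2_Y K_def power2_eq_square algebra_simps)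
  moreover have "U2 1 = 1 * 1"
    by (simp add: U2_1)
  moreover have "2 * (1 + Y) \<in> int_polys Y"
    by (intro closed)
  ultimately obtain r where r: "r \<in> int_polys Y" "U2 (1 * (Y ^ 1 * f)) = 1 * (2 ^ 1 * Y * r)"
    using U2_int_polys[of Y 1 1 1 _ f 1] int_polys_intros(1)[OF Y_0] f by blast
  have "U2 (powX 2 Phi * (Y * f)) = Phi * (2 * Y * r)"
    using U2_mult_powX[of "Y * f" Phi] r(2) by (simp add: ac_simps)
  with r(1) show ?thesis by blast
qed

text \<open>\<open>4\<^sup>s G2(-q)\<^sup>s\<close> is divisible by \<open>Y(-q)\<^sup>s\<close>, so \<open>U2\<close> gains \<open>2\<^sup>s\<close>; of the denominator \<open>4\<^sup>s\<close> only \<open>2\<^sup>s\<close>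
  remains.\<close>

lemma L_1_int_polys:
  assumes "s \<ge> 1"
  shows "\<exists>r\<in>int_polys Y. 2 ^ s * L s 1 = powX 2 Phi * (Y * r)"
proof -
  let ?y = "negX Y"
  let ?f = "((1 + 2 * ?y) ^ 2 * (1 + ?y)) ^ s"
  have "?f \<in> int_polys ?y"
    by (intro int_polys_closed) simp_all
  then obtain r where r: "r \<in> int_polys Y" "U2 (Phi * (?y ^ s * ?f)) = powX 2 Phi * (2 ^ s * Y * r)"
    using U2_Phi_int_polys[of ?y ?f s] assms by blast
  have "?y ^ s * ?f = (4 * negX G2) ^ s"
    unfolding G2_negX by (simp add: power_mult_distrib)
  also have "\<dots> = 2 ^ (2 * s) * negX G2 ^ s"
    by (simp add: power_mult_distrib power_mult)
  finally have "Phi * (?y ^ s * ?f) = 2 ^ (2 * s) * (Phi * negX G2 ^ s)"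
    by (simp only: mult.left_commute)
  then have "U2 (Phi * (?y ^ s * ?f)) = 2 ^ (2 * s) * L s 1"
    by (simp only: U2_two_power_mult L.simps One_nat_def)
  then have "2 ^ s * (2 ^ s * L s 1) = U2 (Phi * (?y ^ s * ?f))"
    by (simp only: mult_2 power_add mult.assoc)
  also have "\<dots> = 2 ^ s * (powX 2 Phi * (Y * r))"
    unfolding r(2) by (simp only: ac_simps)
  finally have "2 ^ s * L s 1 = powX 2 Phi * (Y * r)"
    unfolding mult_cancel_left by simp
  with r(1) show ?thesis by blast
qed

section \<open>The bounds\<close>

definition prefactor :: "nat \<Rightarrow> int fps" where
  "prefactor n = (if odd n then powX 2 Phi else Phi)"

text \<open>Every further application of \<open>U2\<close> gains a factor 2 and exchanges the two prefactors.\<close>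

lemma L_int_polys:
  assumes "s \<ge> 1"
  shows "\<exists>r\<in>int_polys Y. 2 ^ s * L s (Suc n) = prefactor (Suc n) * (2 ^ n * Y * r)"
proof (induction n)
  case 0
  then show ?case using L_1_int_polys[OF assms] by (simp add: prefactor_def)
next
  case (Suc n)
  then obtain r where r: "r \<in> int_polys Y" "2 ^ s * L s (Suc n) = prefactor (Suc n) * (2 ^ n * Y * r)"
    by blast
  obtain r' where r': "r' \<in> int_polys Y"
    "U2 (prefactor (Suc n) * (Y * r)) = prefactor (Suc (Suc n)) * (2 * Y * r')"
    using U2_powX_Phi_int_polys[OF r(1)] U2_Phi_int_polys[OF _ r(1), of 1]
    by (cases "even n") (auto simp: prefactor_def)
  have "2 ^ s * L s (Suc (Suc n)) = U2 (2 ^ s * L s (Suc n))"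
    by (simp add: U2_two_power_mult)
  also have "\<dots> = U2 (2 ^ n * (prefactor (Suc n) * (Y * r)))"
    unfolding r(2) by (simp only: ac_simps)
  also have "\<dots> = prefactor (Suc (Suc n)) * (2 ^ Suc n * Y * r')"
    unfolding U2_two_power_mult r'(2) by (simp add: ac_simps)
  finally show ?case using r'(1) by blast
qed

text \<open>Rewriting a polynomial in \<open>Y = 4 G8\<close> in powers of \<open>G8\<close> multiplies its \<open>j\<close>-th coefficient by \<open>4\<^sup>j\<close>, and
  the expansion in powers of \<open>G8\<close> is unique.\<close>

lemma expansion_coeff:
  assumes a: "G8_expansion F P a" and P: "P $ 0 = 1"
    and F: "2 ^ s * F = P * (2 ^ e * Y * r)" and r: "r \<in> int_polys Y"
  shows "\<exists>t. 2 ^ s * a j = 2 ^ (e + 2 * j) * t"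
proof -
  have "Y * r \<in> int_polys Y"
    using r by (intro int_polys_closed) simp_all
  then obtain p where p: "Y * r = fps_of_poly p oo Y"
    unfolding int_polys_def by blast
  have Y_compose: "Y = (fps_const 4 * fps_X) oo G8"
    by (simp add: Y_def compose_ring_simps numeral_fps_const)
  have Yr: "Y * r = (fps_of_poly p oo (fps_const 4 * fps_X)) oo G8"
    unfolding p unfolding Y_compose by (rule fps_compose_assoc) simp_all
  have "F = P * (Abs_fps a oo G8)"
  proof -
    have "P * (F * recip P) = F"
      using recip_mult[OF P] by (simp add: mult.left_commute)
    then show ?thesis
      using a unfolding G8_expansion_iff[OF P] by simp
  qed
  then have "P * (2 ^ s * (Abs_fps a oo G8)) = P * (2 ^ e * (Y * r))"
    using F by (simp add: ac_simps)
  moreover have "P \<noteq> 0"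
    using P by auto
  ultimately have "2 ^ s * (Abs_fps a oo G8) = 2 ^ e * (Y * r)"
    by simp
  then have "(fps_const (2 ^ s) * Abs_fps a - fps_const (2 ^ e) * (fps_of_poly p oo (fps_const 4 * fps_X))) oo G8 = 0"
    unfolding Yr by (simp add: compose_ring_simps flip: fps_const_power numeral_fps_const)
  moreover have "G8 \<noteq> 0"
    using G8_nth_1 by auto
  ultimately have "fps_const (2 ^ s) * Abs_fps a = fps_const (2 ^ e) * (fps_of_poly p oo (fps_const 4 * fps_X))"
    by (subst (asm) fps_compose_eq_0_iff) auto
  then have "2 ^ s * a j = 2 ^ e * (4 ^ j * coeff p j)"
    using fps_nth_compose_linear[of "fps_of_poly p" 4 j]
    by (metis fps_mult_left_const_nth fps_nth_Abs_fps fps_of_poly_nth)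
  also have "\<dots> = 2 ^ (e + 2 * j) * coeff p j"
    by (simp add: power_add power_mult)
  finally show ?thesis ..
qed

lemma pi2_ge:
  assumes "2 ^ s * a = 2 ^ n * t"
  shows "pi2 a \<ge> ereal (real_of_int (int n - int s))"
proof (cases "a = 0")
  case False
  have "2 ^ n dvd 2 ^ s * a"
    unfolding assms by simp
  then have "n \<le> multiplicity 2 (2 ^ s * a)"
    using False by (intro multiplicity_geI) auto
  also have "\<dots> = s + multiplicity 2 a"
    using False by (subst prime_elem_multiplicity_mult_distrib) auto
  finally show ?thesis
    using False by (simp add: pi2_def)
qed (simp add: pi2_def)

lemma powX_Phi: "powX 2 Phi = Phi2 oo - (fps_X ^ 2)"
  by (subst fps_compose_assoc [symmetric]) (simp_all add: fps_compose_uminus)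

lemma pi2_G8_coeff:
  assumes "s \<ge> 1" "n \<ge> 1"
  shows "pi2 ((THE a. G8_expansion (L s n) (prefactor n) a) j) \<ge> ereal (real_of_int (int n + 2 * int j - int s - 1))"
proof -
  define a where "a = (THE a. G8_expansion (L s n) (prefactor n) a)"
  have P: "prefactor n $ 0 = 1"
    by (simp add: prefactor_def Phi2_nth_0)
  have a: "G8_expansion (L s n) (prefactor n) a"
    unfolding a_def by (rule theI'[OF G8_expansion_ex1[OF L_nth_0[OF assms(1)] P]])
  obtain r where r: "r \<in> int_polys Y" "2 ^ s * L s n = prefactor n * (2 ^ (n - 1) * Y * r)"
    using L_int_polys[OF assms(1), of "n - 1"] assms(2) by auto
  obtain t where "2 ^ s * a j = 2 ^ (n - 1 + 2 * j) * t"
    using expansion_coeff[OF a P r(2,1)] by blast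
  from pi2_ge[OF this]
  have "pi2 (a j) \<ge> ereal (real_of_int (int (n - 1 + 2 * j) - int s))" .
  also have "int (n - 1 + 2 * j) - int s = int n + 2 * int j - int s - 1"
    using assms(2) by simp
  finally show ?thesis
    unfolding a_def .
qed

theorem theorem3p11:
  fixes s :: nat
  assumes "s \<ge> 1"
  shows "\<forall>\<alpha>\<ge>1. \<forall>j\<ge>1.
    pi2 (c_coeff s \<alpha> j) \<ge> ereal (real_of_int (2 * int \<alpha> + 2 * int j - int s - 2)) \<and>
    pi2 (b_coeff s \<alpha> j) \<ge> ereal (real_of_int (2 * int \<alpha> + 2 * int j - int s - 1))"
proof (intro allI impI conjI)
  fix \<alpha> j :: nat
  assume \<alpha>: "\<alpha> \<ge> 1"
  then have "odd (2 * \<alpha> - 1)" by simp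
  then have "c_coeff s \<alpha> = (THE a. G8_expansion (L s (2 * \<alpha> - 1)) (prefactor (2 * \<alpha> - 1)) a)"
    unfolding c_coeff_def by (simp add: prefactor_def powX_Phi)
  with pi2_G8_coeff[OF assms, of "2 * \<alpha> - 1" j] \<alpha>
  show "pi2 (c_coeff s \<alpha> j) \<ge> ereal (real_of_int (2 * int \<alpha> + 2 * int j - int s - 2))"
    by (simp add: of_nat_diff algebra_simps)
  have "b_coeff s \<alpha> = (THE a. G8_expansion (L s (2 * \<alpha>)) (prefactor (2 * \<alpha>)) a)"
    unfolding b_coeff_def by (simp add: prefactor_def)
  with pi2_G8_coeff[OF assms, of "2 * \<alpha>" j] \<alpha>
  show "pi2 (b_coeff s \<alpha> j) \<ge> ereal (real_of_int (2 * int \<alpha> + 2 * int j - int s - 1))"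
    by (simp add: algebra_simps)
qed

end
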